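(* Let $h : Q \to P$ be an injective, quasi-finite map of fine monoids. Then $\operatorname{Spec} h : \operatorname{Spec} P \to \operatorname{Spec} Q$ is an open embedding on the level of topological spaces. If, furthermore, $\operatorname{Spec} h$ is a homeomorphism (equivalently: is surjective), then $h$ is finite. It follows that $h$ can be factored as $Q \to F^{-1}Q \to P$, where $F = h^{-1}(P^* )$ (a face of $Q$), with $F^{-1}Q \to P$ finite and injective.
   Context: Monoids are commutative, written additively, with $0$. $P^*$ is the group of units of $P$, and $P^{\rm gp}$ its groupification. $P$ is fine if it is finitely generated and $P \to P^{\rm gp}$ is injective. A face of $P$ is a submonoid $F$ such that $p+p' \in F$ implies $p,p' \in F$; $F^{-1}P$ denotes the localization of $P$ at $F$. The topological space $\operatorname{Spec} P$ is the set of faces of $P$, with basis of open sets $U_p = \{F : p \in F\}$ ($p \in P$); $\operatorname{Spec} h$ is the map $F \mapsto h^{-1}(F)$. A monoid map $h : Q \to P$ is finite if there is a finite subset $S \subseteq P$ such that every element of $P$ is of the form $h(q)+s$ with $q \in Q$, $s \in S$. A map $h : Q \to P$ of fine monoids is quasi-finite if the map of schemes $\operatorname{Spec} \mathbb{Z}[P] \to \operatorname{Spec} \mathbb{Z}[Q]$ induced on monoid algebras is quasi-finite (of finite type with finite fibers); equivalently, for every face $F$ of $P$, the group homomorphism $(h^{-1}(F)^{-1}Q)^* \to (F^{-1}P)^*$ has finite cokernel. *)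

theory Defs
  imports "HOL-Analysis.Analysis" "HOL-Algebra.Algebra" "HOL-Library.Poly_Mapping"
begin

text \<open>
  Commutative monoids are those of HOL-Algebra (locale \<^locale>\<open>comm_monoid\<close>), so they are written
  multiplicatively: the sum and the zero of the additive notation are the operation and the unit
  of the record, and the group of units is \<^term>\<open>Units P\<close>.
\<close>

definition monoid_hom :: "('a, 'm) monoid_scheme \<Rightarrow> ('b, 'n) monoid_scheme \<Rightarrow> ('a \<Rightarrow> 'b) \<Rightarrow> bool" where
  "monoid_hom Q P h \<longleftrightarrow> h \<in> hom Q P \<and> h \<one>\<^bsub>Q\<^esub> = \<one>\<^bsub>P\<^esub>"

definition finitely_generated_monoid :: "('a, 'm) monoid_scheme \<Rightarrow> bool" where
  "finitely_generated_monoid P \<longleftrightarrow>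
     (\<exists>S. finite S \<and> S \<subseteq> carrier P \<and> (\<forall>H. submonoid H P \<and> S \<subseteq> H \<longrightarrow> H = carrier P))"

definition face :: "('a, 'm) monoid_scheme \<Rightarrow> 'a set \<Rightarrow> bool" where
  "face P F \<longleftrightarrow> submonoid F P \<and>
     (\<forall>p\<in>carrier P. \<forall>p'\<in>carrier P. p \<otimes>\<^bsub>P\<^esub> p' \<in> F \<longrightarrow> p \<in> F \<and> p' \<in> F)"


subsection \<open>Localization and groupification\<close>

text \<open>
  The pair \<open>(p, f)\<close> stands for the formal difference \<open>p - f\<close>. The extra element \<open>g\<close> makes the
  relation transitive when the monoid is not cancellative.
\<close>

definition loc_rel :: "('a, 'm) monoid_scheme \<Rightarrow> 'a set \<Rightarrow> (('a \<times> 'a) \<times> ('a \<times> 'a)) set" where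
  "loc_rel P F = {((p, f), (p', f')). p \<in> carrier P \<and> f \<in> F \<and> p' \<in> carrier P \<and> f' \<in> F \<and>
     (\<exists>g\<in>F. p \<otimes>\<^bsub>P\<^esub> f' \<otimes>\<^bsub>P\<^esub> g = p' \<otimes>\<^bsub>P\<^esub> f \<otimes>\<^bsub>P\<^esub> g)}"

definition localization :: "('a, 'm) monoid_scheme \<Rightarrow> 'a set \<Rightarrow> ('a \<times> 'a) set monoid" where
  "localization P F =
     \<lparr>carrier = (carrier P \<times> F) // loc_rel P F,
      mult = (\<lambda>A B. \<Union>(p, f)\<in>A. \<Union>(p', f')\<in>B. loc_rel P F `` {(p \<otimes>\<^bsub>P\<^esub> p', f \<otimes>\<^bsub>P\<^esub> f')}),
      one = loc_rel P F `` {(\<one>\<^bsub>P\<^esub>, \<one>\<^bsub>P\<^esub>)}\<rparr>"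

definition loc_map :: "('a, 'm) monoid_scheme \<Rightarrow> 'a set \<Rightarrow> 'a \<Rightarrow> ('a \<times> 'a) set" where
  "loc_map P F p = loc_rel P F `` {(p, \<one>\<^bsub>P\<^esub>)}"

text \<open>The groupification of \<open>P\<close> is the localization of \<open>P\<close> at the face \<open>P\<close>.\<close>

definition fine_monoid :: "('a, 'm) monoid_scheme \<Rightarrow> bool" where
  "fine_monoid P \<longleftrightarrow> comm_monoid P \<and> finitely_generated_monoid P \<and>
     inj_on (loc_map P (carrier P)) (carrier P)"


subsection \<open>The spectrum of a monoid\<close>

text \<open>
  The sets \<open>U p = {F. face P F \<and> p \<in> F}\<close> form a basis and not just a subbasis:
  \<open>U p \<inter> U q\<close> is \<open>U\<close> of the product of \<open>p\<close> and \<open>q\<close>, and \<open>U \<one>\<close> is everything.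
\<close>

definition monoid_Spec :: "('a, 'm) monoid_scheme \<Rightarrow> 'a set topology" where
  "monoid_Spec P = topology_generated_by ((\<lambda>p. {F. face P F \<and> p \<in> F}) ` carrier P)"

definition Spec_map :: "('a, 'm) monoid_scheme \<Rightarrow> ('a \<Rightarrow> 'b) \<Rightarrow> 'b set \<Rightarrow> 'a set" where
  "Spec_map Q h F = {q \<in> carrier Q. h q \<in> F}"


subsection \<open>Monoid algebras and quasi-finite maps\<close>

text \<open>
  The monoid algebra over the integers: finitely supported integer-valued functions on the
  carrier, with the bilinear extension of the monoid operation as product.
\<close>

definition monoid_algebra :: "('a, 'm) monoid_scheme \<Rightarrow> ('a \<Rightarrow>\<^sub>0 int) ring" where
  "monoid_algebra P =
     \<lparr>carrier = {x. Poly_Mapping.keys x \<subseteq> carrier P},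
      mult = (\<lambda>x y. frag_extend (\<lambda>p. frag_extend (\<lambda>p'. frag_of (p \<otimes>\<^bsub>P\<^esub> p')) y) x),
      one = frag_of \<one>\<^bsub>P\<^esub>,
      ring.zero = 0,
      ring.add = (+)\<rparr>"

definition algebra_map :: "('a \<Rightarrow> 'b) \<Rightarrow> ('a \<Rightarrow>\<^sub>0 int) \<Rightarrow> ('b \<Rightarrow>\<^sub>0 int)" where
  "algebra_map h = frag_extend (\<lambda>q. frag_of (h q))"

text \<open>
  For a homomorphism \<open>\<phi>\<close> from \<open>A\<close> to \<open>B\<close> of commutative rings: the induced map of affine schemes
  is of finite type with finite fibers. The fiber over the point \<open>I\<close> of the spectrum of \<open>A\<close> is
  the set of prime ideals of \<open>B\<close> that contract to \<open>I\<close>.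
\<close>

definition quasi_finite_ring_map ::
  "('a, 'm) ring_scheme \<Rightarrow> ('b, 'n) ring_scheme \<Rightarrow> ('a \<Rightarrow> 'b) \<Rightarrow> bool" where
  "quasi_finite_ring_map A B \<phi> \<longleftrightarrow>
     (\<exists>S. finite S \<and> S \<subseteq> carrier B \<and> generate_ring B (\<phi> ` carrier A \<union> S) = carrier B) \<and>
     (\<forall>I. primeideal I A \<longrightarrow> finite {J. primeideal J B \<and> {a \<in> carrier A. \<phi> a \<in> J} = I})"

definition quasi_finite_monoid_map ::
  "('a, 'm) monoid_scheme \<Rightarrow> ('b, 'n) monoid_scheme \<Rightarrow> ('a \<Rightarrow> 'b) \<Rightarrow> bool" where
  "quasi_finite_monoid_map Q P h \<longleftrightarrow>
     quasi_finite_ring_map (monoid_algebra Q) (monoid_algebra P) (algebra_map h)"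

definition finite_monoid_map ::
  "('a, 'm) monoid_scheme \<Rightarrow> ('b, 'n) monoid_scheme \<Rightarrow> ('a \<Rightarrow> 'b) \<Rightarrow> bool" where
  "finite_monoid_map Q P h \<longleftrightarrow>
     (\<exists>S. finite S \<and> S \<subseteq> carrier P \<and> (\<forall>p\<in>carrier P. \<exists>q\<in>carrier Q. \<exists>s\<in>S. p = h q \<otimes>\<^bsub>P\<^esub> s))"

end

theory Submission
  imports Defs
begin

text \<open>
  Quasi-finiteness is only used through the torsion of the cokernels at the faces: every element
  \<open>f\<close> of a face \<open>F\<close> of \<open>P\<close> has a positive power in the group generated by \<open>h E\<close>, where
  \<open>E = h\<inverse> F\<close>. This alone makes \<open>F \<mapsto> h\<inverse> F\<close> injective.

  Let \<open>E0 = h\<inverse> P\<^sup>*\<close>. The key step is that every \<open>p\<close> in \<open>P\<close> satisfies \<open>p ^ n * h e = h q\<close> for some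
  \<open>n > 0\<close>, \<open>e\<close> in \<open>E0\<close> and \<open>q\<close> in \<open>Q\<close>. Geometrically, torsion at the minimal faces above the units
  says that the extremal rays of the cone of \<open>P\<close> are rays of \<open>Q\<close>; algebraically, the generators of
  \<open>P\<close> are discarded one at a time, each having a power in the monoid generated by the remaining ones
  and the elements already known to be of the required form.

  Consequently the faces of \<open>P\<close> are the faces of \<open>Q\<close> that contain \<open>E0\<close>, and on these, membership
  of \<open>p\<close> becomes membership of \<open>q\<close>, so the spectrum map is open. Moreover each of the finitely many
  generators of \<open>P\<close> has a power in the image of the localization of \<open>Q\<close> at \<open>E0\<close>, which gives
  finiteness; if the spectrum map is surjective, then \<open>E0\<close> is the group of units of \<open>Q\<close>.
\<close>

subsection \<open>Monoid algebras and evaluations\<close>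

text \<open>The additive extension of \<open>w\<close> to formal sums. The values are real because
  the evaluations used later are exponentials of real-valued characters.\<close>

definition alg_eval :: "('a \<Rightarrow> real) \<Rightarrow> ('a \<Rightarrow>\<^sub>0 int) \<Rightarrow> real" where
  "alg_eval w x = (\<Sum>p\<in>Poly_Mapping.keys x. of_int (Poly_Mapping.lookup x p) * w p)"

lemma alg_eval_zero [simp]: "alg_eval w 0 = 0"
  by (simp add: alg_eval_def)

lemma alg_eval_frag_of [simp]: "alg_eval w (frag_of p) = w p"
  by (simp add: alg_eval_def)

lemma alg_eval_superset:
  assumes "finite A" "Poly_Mapping.keys x \<subseteq> A"
  shows "alg_eval w x = (\<Sum>p\<in>A. of_int (Poly_Mapping.lookup x p) * w p)"
  unfolding alg_eval_def using assms
  by (intro sum.mono_neutral_left) (auto simp: in_keys_iff)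

lemma alg_eval_add [simp]: "alg_eval w (x + y) = alg_eval w x + alg_eval w y"
proof -
  let ?A = "Poly_Mapping.keys x \<union> Poly_Mapping.keys y"
  have "alg_eval w z = (\<Sum>p\<in>?A. of_int (Poly_Mapping.lookup z p) * w p)"
    if "z \<in> {x, y, x + y}" for z
    using that Poly_Mapping.keys_add[of x y] by (intro alg_eval_superset) auto
  then show ?thesis
    by (simp add: lookup_add distrib_right sum.distrib)
qed

lemma alg_eval_minus [simp]: "alg_eval w (- x) = - alg_eval w x"
  using alg_eval_add[of w x "- x"] by (simp del: alg_eval_add)

lemma alg_eval_diff [simp]: "alg_eval w (x - y) = alg_eval w x - alg_eval w y"
  using alg_eval_add[of w x "- y"] by simp

lemma alg_eval_algebra_map: "alg_eval w (algebra_map h x) = alg_eval (w \<circ> h) x"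
  using subset_UNIV[of "Poly_Mapping.keys x"]
  by (induction x rule: frag_induction) (auto simp: algebra_map_def frag_extend_diff)

lemma alg_eval_cong:
  "(\<And>p. p \<in> Poly_Mapping.keys x \<Longrightarrow> w p = w' p) \<Longrightarrow> alg_eval w x = alg_eval w' x"
  by (simp add: alg_eval_def)

lemma algebra_map_carrier:
  assumes "h \<in> carrier Q \<rightarrow> carrier P" "x \<in> carrier (monoid_algebra Q)"
  shows "algebra_map h x \<in> carrier (monoid_algebra P)"
  using assms keys_frag_extend[of "\<lambda>q. frag_of (h q)" x]
  by (force simp: monoid_algebra_def algebra_map_def)

lemma monoid_algebra_mult_frag_of [simp]:
  "frag_of p \<otimes>\<^bsub>monoid_algebra P\<^esub> frag_of q = frag_of (p \<otimes>\<^bsub>P\<^esub> q)"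
  by (simp add: monoid_algebra_def)

lemma monoid_algebra_mult_diff_left:
  "(x - x') \<otimes>\<^bsub>monoid_algebra P\<^esub> y =
    (x \<otimes>\<^bsub>monoid_algebra P\<^esub> y) - (x' \<otimes>\<^bsub>monoid_algebra P\<^esub> y)"
  by (simp add: monoid_algebra_def frag_extend_diff)

lemma monoid_algebra_mult_add_left:
  "(x + x') \<otimes>\<^bsub>monoid_algebra P\<^esub> y =
    (x \<otimes>\<^bsub>monoid_algebra P\<^esub> y) + (x' \<otimes>\<^bsub>monoid_algebra P\<^esub> y)"
  by (simp add: monoid_algebra_def frag_extend_add)

lemma monoid_algebra_mult_zero_left: "0 \<otimes>\<^bsub>monoid_algebra P\<^esub> y = 0"
  by (simp add: monoid_algebra_def)

text \<open>The outer extension in the product runs over the left factor, so linearity on the right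
  is reached by induction on the left factor.\<close>

lemma monoid_algebra_mult_diff_right:
  "y \<otimes>\<^bsub>monoid_algebra P\<^esub> (x - x') =
    (y \<otimes>\<^bsub>monoid_algebra P\<^esub> x) - (y \<otimes>\<^bsub>monoid_algebra P\<^esub> x')"
  using subset_UNIV[of "Poly_Mapping.keys y"]
proof (induction y rule: frag_induction)
  case (diff a b)
  then show ?case by (simp add: monoid_algebra_mult_diff_left)
qed (auto simp: monoid_algebra_def frag_extend_diff)

lemma monoid_algebra_mult_zero_right: "y \<otimes>\<^bsub>monoid_algebra P\<^esub> 0 = 0"
  using monoid_algebra_mult_diff_right[where x = 0 and x' = 0] by simp

lemmas monoid_algebra_bilinear =
  monoid_algebra_mult_diff_left monoid_algebra_mult_diff_right
  monoid_algebra_mult_zero_left monoid_algebra_mult_zero_right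

lemma monoid_algebra_carrier: "x \<in> carrier (monoid_algebra P) \<longleftrightarrow> Poly_Mapping.keys x \<subseteq> carrier P"
  by (simp add: monoid_algebra_def)

lemma monoid_algebra_simps [simp]:
  "\<one>\<^bsub>monoid_algebra P\<^esub> = frag_of \<one>\<^bsub>P\<^esub>"
  "\<zero>\<^bsub>monoid_algebra P\<^esub> = 0"
  "x \<oplus>\<^bsub>monoid_algebra P\<^esub> y = x + y"
  by (simp_all add: monoid_algebra_def)

text \<open>Basis elements generate the algebra as an abelian group, and differences produce both
  sums and negatives. Identities additive in each argument thus reduce to identities in the
  monoid.\<close>

lemma monoid_algebra_induct [consumes 1, case_names zero one diff]:
  assumes "x \<in> carrier (monoid_algebra P)"
    and "T 0" "\<And>p. p \<in> carrier P \<Longrightarrow> T (frag_of p)" "\<And>a b. T a \<Longrightarrow> T b \<Longrightarrow> T (a - b)"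
  shows "T x"
  using assms by (auto simp: monoid_algebra_carrier intro: frag_induction[of x "carrier P" T])

lemma monoid_algebra_diff_closed:
  assumes "x \<in> carrier (monoid_algebra P)" "y \<in> carrier (monoid_algebra P)"
  shows "x - y \<in> carrier (monoid_algebra P)"
  using assms keys_diff[of x y] by (auto simp: monoid_algebra_carrier)

lemma (in comm_monoid) monoid_algebra_mult_closed:
  assumes "x \<in> carrier (monoid_algebra G)" "y \<in> carrier (monoid_algebra G)"
  shows "x \<otimes>\<^bsub>monoid_algebra G\<^esub> y \<in> carrier (monoid_algebra G)"
  using assms(1)
proof (induction x rule: monoid_algebra_induct)
  case (one p)
  show ?case
    using assms(2) one
    by (induction y rule: monoid_algebra_induct)
      (auto simp: monoid_algebra_bilinear monoid_algebra_diff_closed, auto simp: monoid_algebra_carrier)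
qed (auto simp: monoid_algebra_bilinear monoid_algebra_diff_closed, auto simp: monoid_algebra_carrier)

lemma (in comm_monoid) monoid_algebra_comm:
  assumes "x \<in> carrier (monoid_algebra G)" "y \<in> carrier (monoid_algebra G)"
  shows "x \<otimes>\<^bsub>monoid_algebra G\<^esub> y = y \<otimes>\<^bsub>monoid_algebra G\<^esub> x"
  using assms(1)
proof (induction x rule: monoid_algebra_induct)
  case (one p)
  show ?case
    using assms(2) one
    by (induction y rule: monoid_algebra_induct) (auto simp: monoid_algebra_bilinear m_comm)
qed (auto simp: monoid_algebra_bilinear)

lemma (in comm_monoid) monoid_algebra_assoc:
  assumes "x \<in> carrier (monoid_algebra G)" "y \<in> carrier (monoid_algebra G)"
    "z \<in> carrier (monoid_algebra G)"
  shows "(x \<otimes>\<^bsub>monoid_algebra G\<^esub> y) \<otimes>\<^bsub>monoid_algebra G\<^esub> z =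
    x \<otimes>\<^bsub>monoid_algebra G\<^esub> (y \<otimes>\<^bsub>monoid_algebra G\<^esub> z)"
  using assms(1)
proof (induction x rule: monoid_algebra_induct)
  case (one p)
  show ?case
    using assms(2)
  proof (induction y rule: monoid_algebra_induct)
    case (one q)
    show ?case
      using assms(3) \<open>p \<in> carrier G\<close> one
      by (induction z rule: monoid_algebra_induct) (auto simp: monoid_algebra_bilinear m_assoc)
  qed (auto simp: monoid_algebra_bilinear)
qed (auto simp: monoid_algebra_bilinear)

lemma (in comm_monoid) monoid_algebra_l_one:
  assumes "x \<in> carrier (monoid_algebra G)"
  shows "frag_of \<one> \<otimes>\<^bsub>monoid_algebra G\<^esub> x = x"
  using assms
  by (induction x rule: monoid_algebra_induct) (auto simp: monoid_algebra_bilinear)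

lemma (in comm_monoid) monoid_algebra_cring: "cring (monoid_algebra G)"
proof (rule cringI)
  show "abelian_group (monoid_algebra G)"
  proof (rule abelian_groupI)
    fix x assume x: "x \<in> carrier (monoid_algebra G)"
    then show "\<exists>y\<in>carrier (monoid_algebra G). y \<oplus>\<^bsub>monoid_algebra G\<^esub> x = \<zero>\<^bsub>monoid_algebra G\<^esub>"
      by (intro bexI[of _ "- x"]) (auto simp: monoid_algebra_carrier)
  next
    fix x y assume "x \<in> carrier (monoid_algebra G)" "y \<in> carrier (monoid_algebra G)"
    then show "x \<oplus>\<^bsub>monoid_algebra G\<^esub> y \<in> carrier (monoid_algebra G)"
      using Poly_Mapping.keys_add[of x y] by (auto simp: monoid_algebra_carrier)
  qed (auto simp: monoid_algebra_carrier add_ac)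
  show "comm_monoid (monoid_algebra G)"
    by (rule comm_monoidI)
      (simp_all add: monoid_algebra_mult_closed monoid_algebra_assoc monoid_algebra_l_one,
        simp_all add: monoid_algebra_comm monoid_algebra_carrier)
qed (simp add: monoid_algebra_mult_add_left)

lemma (in comm_monoid) alg_eval_mult:
  assumes w: "\<And>p q. p \<in> carrier G \<Longrightarrow> q \<in> carrier G \<Longrightarrow> w (p \<otimes> q) = w p * w q"
    and "x \<in> carrier (monoid_algebra G)" "y \<in> carrier (monoid_algebra G)"
  shows "alg_eval w (x \<otimes>\<^bsub>monoid_algebra G\<^esub> y) = alg_eval w x * alg_eval w y"
  using assms(2)
proof (induction x rule: monoid_algebra_induct)
  case (one p)
  show ?case
    using assms(3)
    by (induction y rule: monoid_algebra_induct)
      (auto simp: monoid_algebra_bilinear w one algebra_simps)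
qed (auto simp: monoid_algebra_bilinear algebra_simps)

text \<open>A multiplicative \<open>w\<close> extends to a ring homomorphism into the reals. Its
  kernel is prime because the reals are a domain; the value 1 at the unit makes it proper.\<close>

lemma (in comm_monoid) primeideal_alg_eval:
  assumes w: "\<And>p q. p \<in> carrier G \<Longrightarrow> q \<in> carrier G \<Longrightarrow> w (p \<otimes> q) = w p * w q"
    and one: "w \<one> = 1"
  shows "primeideal {x \<in> carrier (monoid_algebra G). alg_eval w x = 0} (monoid_algebra G)"
    (is "primeideal ?J ?A")
proof -
  interpret A: cring ?A
    by (rule monoid_algebra_cring)
  show ?thesis
  proof (rule primeidealI2)
    show "additive_subgroup ?J ?A"
    proof (rule additive_subgroupI, rule subgroup.intro)
      fix x assume "x \<in> ?J"
      moreover have "inv\<^bsub>add_monoid ?A\<^esub> x = - x" if "x \<in> carrier ?A"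
      proof -
        have "\<ominus>\<^bsub>?A\<^esub> x = - x"
          by (rule A.minus_equality) (use that in \<open>auto simp: monoid_algebra_carrier\<close>)
        then show ?thesis by (simp add: a_inv_def)
      qed
      ultimately show "inv\<^bsub>add_monoid ?A\<^esub> x \<in> ?J"
        by (auto simp: monoid_algebra_carrier)
    next
      fix x y assume "x \<in> ?J" "y \<in> ?J"
      then show "x \<otimes>\<^bsub>add_monoid ?A\<^esub> y \<in> ?J"
        using A.a_closed[of x y] by auto
    qed (auto simp: monoid_algebra_carrier)
    have "frag_of \<one> \<in> carrier ?A" "frag_of \<one> \<notin> ?J"
      by (auto simp: one monoid_algebra_carrier)
    then show "carrier ?A \<noteq> ?J" by blast
  qed (auto simp: alg_eval_mult w monoid_algebra_mult_closed A.is_cring)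
qed

subsection \<open>Submonoids of finitely generated monoids and additive characters\<close>

text \<open>The clause on \<open>S\<close> in \<open>finitely_generated_monoid\<close>, separated
  from finiteness so that it applies to possibly infinite sets \<open>M \<union> T\<close>.\<close>

definition monoid_generators :: "('a, 'm) monoid_scheme \<Rightarrow> 'a set \<Rightarrow> bool" where
  "monoid_generators P S \<longleftrightarrow> (\<forall>H. submonoid H P \<and> S \<subseteq> H \<longrightarrow> H = carrier P)"

context comm_monoid
begin

text \<open>For a submonoid \<open>M\<close>, the submonoid generated by \<open>M\<close> and
  \<open>t\<close>, in a form where powers of \<open>t\<close> can be cancelled.\<close>

definition adjoin :: "'a set \<Rightarrow> 'a \<Rightarrow> 'a set" where
  "adjoin M t = {x \<otimes> t [^] (n::nat) | x n. x \<in> M}"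

text \<open>The monoid analogue of \<open>G\<close> being integral over \<open>M\<close>.\<close>

definition power_dense :: "'a set \<Rightarrow> bool" where
  "power_dense M \<longleftrightarrow> (\<forall>p\<in>carrier G. \<exists>n::nat. n > 0 \<and> p [^] n \<in> M)"

lemma pow_submonoid:
  assumes "submonoid M G" "x \<in> M"
  shows "x [^] (n::nat) \<in> M"
  using assms by (induction n) (auto simp: submonoid_def)

lemma adjoin_submonoid:
  assumes M: "submonoid M G" and t: "t \<in> carrier G"
  shows "submonoid (adjoin M t) G"
proof
  show "adjoin M t \<subseteq> carrier G"
    using submonoid.subset[OF M] t by (auto simp: adjoin_def)
  show "\<one> \<in> adjoin M t"
    using submonoid.one_closed[OF M] unfolding adjoin_def
    by (intro CollectI exI[of _ \<one>] exI[of _ 0]) auto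
  fix a b assume "a \<in> adjoin M t" "b \<in> adjoin M t"
  then obtain x n y m where xy: "x \<in> M" "y \<in> M" "a = x \<otimes> t [^] (n::nat)" "b = y \<otimes> t [^] (m::nat)"
    by (auto simp: adjoin_def)
  have "x \<in> carrier G" "y \<in> carrier G"
    using submonoid.subset[OF M] xy by auto
  then have "a \<otimes> b = (x \<otimes> y) \<otimes> t [^] (n + m)"
    using t by (simp add: xy nat_pow_mult[symmetric] m_ac)
  then show "a \<otimes> b \<in> adjoin M t"
    using submonoid.m_closed[OF M xy(1,2)] by (auto simp: adjoin_def)
qed

lemma adjoin_superset:
  assumes "submonoid M G" "t \<in> carrier G"
  shows "M \<subseteq> adjoin M t"
proof
  fix x assume "x \<in> M"
  then show "x \<in> adjoin M t"
    using assms submonoid.subset[OF assms(1)] unfolding adjoin_def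
    by (intro CollectI exI[of _ x] exI[of _ 0]) auto
qed

lemma adjoin_generator:
  assumes "submonoid M G" "t \<in> carrier G"
  shows "t \<in> adjoin M t"
  using assms submonoid.one_closed[OF assms(1)] unfolding adjoin_def
  by (intro CollectI exI[of _ \<one>] exI[of _ 1]) auto

text \<open>\<open>M\<close> grows by the elements of \<open>T\<close> one after another until it is
  all of \<open>G\<close>; \<open>step\<close> carries \<open>R\<close> back down this
  chain.\<close>

lemma submonoid_down_induct_aux:
  assumes "finite T" "T \<subseteq> carrier G" "submonoid M G" "monoid_generators G (M \<union> T)"
    and top: "R (carrier G)"
    and step: "\<And>M t. submonoid M G \<Longrightarrow> t \<in> carrier G \<Longrightarrow> R (adjoin M t) \<Longrightarrow> R M"
  shows "R M"
  using assms(1-4)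
proof (induction T arbitrary: M rule: finite_induct)
  case empty
  then show ?case
    using top by (auto simp: monoid_generators_def)
next
  case (insert t T)
  have "R (adjoin M t)"
  proof (rule insert.IH)
    show "monoid_generators G (adjoin M t \<union> T)"
      using insert.prems adjoin_superset[of M t] adjoin_generator[of M t]
      by (auto simp: monoid_generators_def)
  qed (use insert.prems in \<open>auto simp: adjoin_submonoid\<close>)
  then show ?case
    using step insert.prems by auto
qed

lemma submonoid_down_induct [consumes 2, case_names top step]:
  assumes "finitely_generated_monoid G" "submonoid M G"
    and "R (carrier G)"
    and "\<And>M t. submonoid M G \<Longrightarrow> t \<in> carrier G \<Longrightarrow> R (adjoin M t) \<Longrightarrow> R M"
  shows "R M"
proof -
  obtain S where "finite S" "S \<subseteq> carrier G" "monoid_generators G S"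
    using assms(1) by (auto simp: finitely_generated_monoid_def monoid_generators_def)
  moreover from this have "monoid_generators G (M \<union> S)"
    by (auto simp: monoid_generators_def)
  ultimately show ?thesis
    using submonoid_down_induct_aux[of S M R] assms by auto
qed

text \<open>Integral and finitely generated implies finite. The finite set is built up while the
  generators of \<open>G\<close> are removed one at a time.\<close>

lemma power_dense_finite:
  assumes "finitely_generated_monoid G" "submonoid M G" "power_dense M"
  shows "\<exists>S. finite S \<and> S \<subseteq> carrier G \<and> (\<forall>p\<in>carrier G. \<exists>m\<in>M. \<exists>s\<in>S. p = m \<otimes> s)"
  using assms
proof (induction M rule: submonoid_down_induct)
  case top
  show ?case
    by (intro exI[of _ "{\<one>}"]) auto
next
  case (step M t)
  have Mc: "M \<subseteq> carrier G"
    using step(1) by (simp add: submonoid_def)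
  have "power_dense (adjoin M t)"
    using step.prems adjoin_superset[OF step(1,2)] by (auto simp: power_dense_def)
  from step.IH[OF this] obtain S
    where S: "finite S" "S \<subseteq> carrier G" "\<And>p. p \<in> carrier G \<Longrightarrow> \<exists>m\<in>adjoin M t. \<exists>s\<in>S. p = m \<otimes> s"
    by blast
  obtain n :: nat where n: "n > 0" "t [^] n \<in> M"
    using step.prems step(2) by (auto simp: power_dense_def)
  \<comment> \<open>Division of exponents of \<open>t\<close> by \<open>n\<close>: the quotient part
    is a power of \<open>t [^] n\<close> and goes into \<open>M\<close>, and only remainders below
    \<open>n\<close> enter the finite set.\<close>
  let ?S = "(\<lambda>(r, s). t [^] r \<otimes> s) ` ({..<n} \<times> S)"
  have "\<exists>m\<in>M. \<exists>s\<in>?S. p = m \<otimes> s" if p: "p \<in> carrier G" for p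
  proof -
    obtain x a s where xs: "x \<in> M" "s \<in> S" "p = x \<otimes> t [^] (a::nat) \<otimes> s"
      using S(3)[OF p] by (auto simp: adjoin_def)
    have "t [^] a = (t [^] n) [^] (a div n) \<otimes> t [^] (a mod n)"
      using step(2) by (simp add: nat_pow_pow nat_pow_mult)
    then have "p = (x \<otimes> (t [^] n) [^] (a div n)) \<otimes> (t [^] (a mod n) \<otimes> s)"
      using xs S(2) Mc step(2) by (auto simp: m_assoc subset_iff)
    moreover have "x \<otimes> (t [^] n) [^] (a div n) \<in> M"
      using n xs pow_submonoid[OF step(1)] submonoid.m_closed[OF step(1)] by blast
    moreover have "t [^] (a mod n) \<otimes> s \<in> ?S"
      using xs n by (intro image_eqI[of _ _ "(a mod n, s)"]) auto
    ultimately show ?thesis by blast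
  qed
  moreover have "finite ?S" "?S \<subseteq> carrier G"
    using S step(2) by auto
  ultimately show ?case by blast
qed

end

text \<open>Characters of \<open>M\<close> with values in the additive group of the reals, whose
  divisibility allows extension to larger monoids.\<close>

definition additive_on :: "('a, 'm) monoid_scheme \<Rightarrow> 'a set \<Rightarrow> ('a \<Rightarrow> real) \<Rightarrow> bool" where
  "additive_on P M \<phi> \<longleftrightarrow> (\<forall>a\<in>M. \<forall>b\<in>M. \<phi> (a \<otimes>\<^bsub>P\<^esub> b) = \<phi> a + \<phi> b)"

context comm_monoid
begin

lemma additive_on_one:
  assumes "submonoid M G" "additive_on G M \<phi>"
  shows "\<phi> \<one> = 0"
proof -
  have "\<phi> (\<one> \<otimes> \<one>) = \<phi> \<one> + \<phi> \<one>"
    using assms submonoid.one_closed unfolding additive_on_def by blast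
  then show ?thesis by simp
qed

lemma additive_on_pow:
  assumes "submonoid M G" "additive_on G M \<phi>" "a \<in> M"
  shows "\<phi> (a [^] (n::nat)) = n * \<phi> a"
proof (induction n)
  case 0
  then show ?case using additive_on_one[OF assms(1,2)] by simp
next
  case (Suc n)
  have "a [^] n \<in> M" using assms pow_submonoid by blast
  then show ?case using assms Suc by (simp add: additive_on_def algebra_simps)
qed

end

context comm_monoid_cancel
begin

text \<open>The assumption on \<open>c\<close> is the compatibility needed to prescribe the value
  \<open>c\<close> at \<open>t\<close>. It mentions \<open>t\<close> on one side only, since
  cancellation reduces every coincidence of two normal forms to that case.\<close>

lemma additive_adjoin:
  fixes c :: real
  assumes M: "submonoid M G" and t: "t \<in> carrier G" and \<phi>: "additive_on G M \<phi>"
    and c: "\<And>k a b. a \<in> M \<Longrightarrow> b \<in> M \<Longrightarrow> a \<otimes> t [^] (k::nat) = b \<Longrightarrow> \<phi> b = \<phi> a + k * c"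
  shows "\<exists>\<phi>'. additive_on G (adjoin M t) \<phi>' \<and> (\<forall>a\<in>M. \<phi>' a = \<phi> a) \<and> \<phi>' t = c"
proof -
  have Mc: "M \<subseteq> carrier G"
    using M by (simp add: submonoid_def)
  have le: "\<phi> x + n * c = \<phi> y + m * c"
    if "x \<in> M" "y \<in> M" "x \<otimes> t [^] n = y \<otimes> t [^] m" "n \<le> m" for x y and n m :: nat
  proof -
    have xy: "x \<in> carrier G" "y \<in> carrier G"
      using that Mc by auto
    have "t [^] (m - n) \<otimes> t [^] n = t [^] m"
      using nat_pow_mult[OF t, of "m - n" n] that(4) by simp
    then have "(y \<otimes> t [^] (m - n)) \<otimes> t [^] n = x \<otimes> t [^] n"
      using xy t that(3) by (simp add: m_assoc)
    then have "y \<otimes> t [^] (m - n) = x"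
      by (rule r_cancel) (use xy t in auto)
    then have "\<phi> x = \<phi> y + real (m - n) * c"
      using c[OF that(2,1), of "m - n"] by simp
    then show ?thesis
      using that by (simp add: of_nat_diff algebra_simps)
  qed
  have wd: "\<phi> x + n * c = \<phi> y + m * c"
    if "x \<in> M" "y \<in> M" "x \<otimes> t [^] n = y \<otimes> t [^] m" for x y and n m :: nat
    using le[of x y n m] le[of y x m n] that by (metis linear)
  \<comment> \<open>The value is independent of the representation of \<open>p\<close> by
    \<open>wd\<close>, so the description is unique on \<open>adjoin M t\<close>.\<close>
  define \<phi>' where "\<phi>' p = (THE v. \<exists>x n. x \<in> M \<and> p = x \<otimes> t [^] (n::nat) \<and> v = \<phi> x + n * c)" for p
  have \<phi>': "\<phi>' (x \<otimes> t [^] n) = \<phi> x + n * c" if "x \<in> M" for x and n :: nat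
    unfolding \<phi>'_def
  proof (rule the_equality)
    show "\<exists>y m. y \<in> M \<and> x \<otimes> t [^] n = y \<otimes> t [^] (m::nat) \<and> \<phi> x + n * c = \<phi> y + m * c"
      using that by blast
    fix v assume "\<exists>y m. y \<in> M \<and> x \<otimes> t [^] n = y \<otimes> t [^] (m::nat) \<and> v = \<phi> y + m * c"
    then show "v = \<phi> x + n * c"
      using wd that by metis
  qed
  have "\<phi>' a = \<phi> a" if "a \<in> M" for a
    using \<phi>'[OF that, of 0] that Mc by auto
  moreover have "\<phi>' t = c"
    using \<phi>'[OF submonoid.one_closed[OF M], of 1] additive_on_one[OF M \<phi>] t by simp
  moreover have "additive_on G (adjoin M t) \<phi>'"
    unfolding additive_on_def
  proof (intro ballI)
    fix a b assume "a \<in> adjoin M t" "b \<in> adjoin M t"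
    then obtain x n y m where xy: "x \<in> M" "y \<in> M" "a = x \<otimes> t [^] (n::nat)" "b = y \<otimes> t [^] (m::nat)"
      by (auto simp: adjoin_def)
    have "x \<in> carrier G" "y \<in> carrier G"
      using Mc xy by auto
    then have "a \<otimes> b = (x \<otimes> y) \<otimes> t [^] (n + m)"
      using t by (simp add: xy nat_pow_mult[symmetric] m_ac)
    then show "\<phi>' (a \<otimes> b) = \<phi>' a + \<phi>' b"
      using \<phi>'[OF submonoid.m_closed[OF M xy(1,2)], of "n + m"] xy \<phi>' \<phi>
      by (simp add: additive_on_def algebra_simps)
  qed
  ultimately show ?thesis by blast
qed

text \<open>If a positive power of \<open>t\<close> is a quotient of elements of \<open>M\<close>,
  the value at \<open>t\<close> is forced and found by dividing by the exponent; otherwise it can be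
  chosen freely.\<close>

lemma additive_extend_one:
  assumes M: "submonoid M G" and t: "t \<in> carrier G" and \<phi>: "additive_on G M \<phi>"
  shows "\<exists>\<phi>'. additive_on G (adjoin M t) \<phi>' \<and> (\<forall>a\<in>M. \<phi>' a = \<phi> a)"
proof (cases "\<exists>k a b. k > (0::nat) \<and> a \<in> M \<and> b \<in> M \<and> a \<otimes> t [^] k = b")
  case True
  then obtain k a b where kab: "k > (0::nat)" "a \<in> M" "b \<in> M" "a \<otimes> t [^] k = b" by blast
  define c where "c = (\<phi> b - \<phi> a) / k"
  have Mc: "M \<subseteq> carrier G"
    using M by (simp add: submonoid_def)
  have "\<phi> b' = \<phi> a' + l * c" if l: "a' \<in> M" "b' \<in> M" "a' \<otimes> t [^] l = b'" for l :: nat and a' b'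
  proof -
    have carr: "a \<in> carrier G" "b \<in> carrier G" "a' \<in> carrier G" "b' \<in> carrier G"
      using Mc kab l by auto
    \<comment> \<open>Raising the two relations to the powers \<open>l\<close> and \<open>k\<close>
      gives both the factor \<open>t [^] (k * l)\<close>, so \<open>t\<close> can be eliminated
      between them.\<close>
    have 1: "a [^] l \<otimes> t [^] (k * l) = b [^] l"
      using carr t by (simp add: kab(4)[symmetric] nat_pow_distrib nat_pow_pow)
    have 2: "a' [^] k \<otimes> t [^] (k * l) = b' [^] k"
      using carr t by (simp add: l(3)[symmetric] nat_pow_distrib nat_pow_pow mult.commute)
    have "a [^] l \<otimes> b' [^] k = b [^] l \<otimes> a' [^] k"
      unfolding 1[symmetric] 2[symmetric] using carr t by (simp add: m_ac)
    moreover have "a [^] l \<in> M" "b [^] l \<in> M" "a' [^] k \<in> M" "b' [^] k \<in> M"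
      using pow_submonoid[OF M] kab l by auto
    ultimately have "\<phi> (a [^] l) + \<phi> (b' [^] k) = \<phi> (b [^] l) + \<phi> (a' [^] k)"
      using \<phi> by (metis additive_on_def)
    then have "l * \<phi> a + k * \<phi> b' = l * \<phi> b + k * \<phi> a'"
      using additive_on_pow[OF M \<phi>] kab l by simp
    then have "k * (\<phi> b' - \<phi> a') = l * (\<phi> b - \<phi> a)"
      by (simp add: algebra_simps)
    also have "\<phi> b - \<phi> a = k * c"
      using kab by (simp add: c_def)
    finally have "k * (\<phi> b' - (\<phi> a' + l * c)) = 0"
      by (simp add: algebra_simps)
    then show ?thesis using kab by simp
  qed
  from additive_adjoin[OF M t \<phi> this] show ?thesis by blast
next
  case False
  \<comment> \<open>The value 0 is chosen at \<open>t\<close>: relations occur only with exponent 0,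
    so compatibility is trivial.\<close>
  have "\<phi> b = \<phi> a + real k * 0" if "a \<in> M" "b \<in> M" "a \<otimes> t [^] k = b" for k :: nat and a b
  proof -
    have "k = 0" using that False by auto
    then show ?thesis using that submonoid.subset[OF M] by auto
  qed
  from additive_adjoin[OF M t \<phi> this] show ?thesis by blast
qed

lemma additive_extend:
  assumes "finitely_generated_monoid G" "submonoid M G" "additive_on G M \<phi>"
  shows "\<exists>\<phi>'. additive_on G (carrier G) \<phi>' \<and> (\<forall>a\<in>M. \<phi>' a = \<phi> a)"
  using assms
proof (induction M arbitrary: \<phi> rule: submonoid_down_induct)
  case (step M t)
  then show ?case
    using additive_extend_one[OF step(1,2)] adjoin_superset[OF step(1,2)] by (metis subsetD)
qed auto

text \<open>Since \<open>x\<close> has no positive power in the group of \<open>M\<close>, the zero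
  character of \<open>M\<close> extends to \<open>adjoin M x\<close> with value 1 at
  \<open>x\<close>, and from there to \<open>G\<close>.\<close>

lemma additive_separating:
  assumes fg: "finitely_generated_monoid G" and M: "submonoid M G" and x: "x \<in> carrier G"
    and notor: "\<And>n a b. n > (0::nat) \<Longrightarrow> a \<in> M \<Longrightarrow> b \<in> M \<Longrightarrow> x [^] n \<otimes> a \<noteq> b"
  shows "\<exists>\<phi>. additive_on G (carrier G) \<phi> \<and> (\<forall>a\<in>M. \<phi> a = 0) \<and> \<phi> x = 1"
proof -
  have 0: "additive_on G M (\<lambda>_. 0)"
    by (simp add: additive_on_def)
  have "\<exists>\<phi>. additive_on G (adjoin M x) \<phi> \<and> (\<forall>a\<in>M. \<phi> a = 0) \<and> \<phi> x = 1"
  proof (rule additive_adjoin[OF M x 0])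
    fix k :: nat and a b assume ab: "a \<in> M" "b \<in> M" "a \<otimes> x [^] k = b"
    then have "x [^] k \<otimes> a = b"
      using submonoid.subset[OF M] x m_comm by auto
    then have "k = 0" using notor ab by blast
    then show "0 = 0 + real k * 1" by simp
  qed
  then obtain \<phi> where \<phi>: "additive_on G (adjoin M x) \<phi>" "\<forall>a\<in>M. \<phi> a = 0" "\<phi> x = 1" by blast
  from additive_extend[OF fg adjoin_submonoid[OF M x] \<phi>(1)] show ?thesis
    using \<phi> adjoin_superset[OF M x] adjoin_generator[OF M x] by (metis subsetD)
qed

end

subsection \<open>Faces and torsion\<close>

lemma monoid_hom_mult:
  "monoid_hom Q P h \<Longrightarrow> a \<in> carrier Q \<Longrightarrow> b \<in> carrier Q \<Longrightarrow> h (a \<otimes>\<^bsub>Q\<^esub> b) = h a \<otimes>\<^bsub>P\<^esub> h b"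
  by (simp add: monoid_hom_def hom_mult)

lemma monoid_hom_closed:
  "monoid_hom Q P h \<Longrightarrow> a \<in> carrier Q \<Longrightarrow> h a \<in> carrier P"
  by (auto simp: monoid_hom_def hom_def)

lemma monoid_hom_one:
  "monoid_hom Q P h \<Longrightarrow> h \<one>\<^bsub>Q\<^esub> = \<one>\<^bsub>P\<^esub>"
  by (simp add: monoid_hom_def)

lemma monoid_hom_pow:
  assumes "monoid_hom Q P h" "comm_monoid Q" "a \<in> carrier Q"
  shows "h (a [^]\<^bsub>Q\<^esub> (n::nat)) = h a [^]\<^bsub>P\<^esub> n"
proof -
  interpret Q: comm_monoid Q by fact
  show ?thesis
    by (induction n) (simp_all add: monoid_hom_one[OF assms(1)] monoid_hom_mult[OF assms(1)] assms(3))
qed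

lemma face_submonoid: "face P F \<Longrightarrow> submonoid F P"
  by (simp add: face_def)

lemma face_mult_iff:
  "face P F \<Longrightarrow> p \<in> carrier P \<Longrightarrow> q \<in> carrier P \<Longrightarrow> p \<otimes>\<^bsub>P\<^esub> q \<in> F \<longleftrightarrow> p \<in> F \<and> q \<in> F"
  unfolding face_def using submonoid.m_closed by metis

lemma (in comm_monoid) face_pow_iff:
  assumes F: "face G F" and p: "p \<in> carrier G" and "n > 0"
  shows "p [^] (n::nat) \<in> F \<longleftrightarrow> p \<in> F"
proof -
  obtain m where "n = Suc m" using \<open>n > 0\<close> gr0_implies_Suc by blast
  then show ?thesis
    using face_mult_iff[OF F, of "p [^] m" p] pow_submonoid[OF face_submonoid[OF F]] p by auto
qed

lemma (in comm_monoid) Units_mult_iff: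
  assumes "p \<in> carrier G" "q \<in> carrier G"
  shows "p \<otimes> q \<in> Units G \<longleftrightarrow> p \<in> Units G \<and> q \<in> Units G"
  using assms unit_factor[of p q] unit_factor[of q p] m_comm[of p q] by auto

lemma (in comm_monoid) face_Units: "face G (Units G)"
  unfolding face_def by (auto simp: Units_mult_iff intro!: submonoid.intro)

text \<open>A unit divides the unit element, which lies in every face.\<close>

lemma (in comm_monoid) Units_subset_face:
  assumes "face G F" shows "Units G \<subseteq> F"
proof
  fix u assume u: "u \<in> Units G"
  then have "u \<otimes> inv u \<in> F"
    using submonoid.one_closed[OF face_submonoid[OF assms]] by simp
  then show "u \<in> F"
    using face_mult_iff[OF assms, of u "inv u"] Units_closed[OF u] u by simp
qed

lemma face_Spec_map:
  assumes h: "monoid_hom Q P h" and Q: "comm_monoid Q" and F: "face P F"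
  shows "face Q (Spec_map Q h F)"
proof -
  interpret Q: comm_monoid Q by fact
  show ?thesis
    unfolding face_def Spec_map_def
    using submonoid.one_closed[OF face_submonoid[OF F]] monoid_hom_one[OF h]
      face_mult_iff[OF F] monoid_hom_closed[OF h] monoid_hom_mult[OF h]
    by (auto intro!: submonoid.intro)
qed

text \<open>
  If no positive multiple of \<open>x\<close> lies in the group of the subface, there are infinitely many primes
  over one prime: a character \<open>\<phi>\<close> with \<open>\<phi> x = 1\<close> that vanishes on the subface yields, for each
  \<open>m \<ge> 1\<close>, the evaluation at \<open>p \<mapsto> m powr \<phi> p\<close> on \<open>F\<close> and \<open>p \<mapsto> 0\<close> off \<open>F\<close>. Its kernel contains
  \<open>x - m\<close>, and its restriction to the algebra of \<open>Q\<close> does not depend on \<open>m\<close>.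
\<close>

lemma quasi_finite_face_torsion:
  fixes Q :: "('a, 'm) monoid_scheme" and P :: "('b, 'n) monoid_scheme"
  assumes P: "comm_monoid_cancel P" "finitely_generated_monoid P" and Q: "comm_monoid Q"
    and h: "monoid_hom Q P h" and qf: "quasi_finite_monoid_map Q P h"
    and F: "face P F" and x: "x \<in> F"
  shows "\<exists>n e e'. n > (0::nat) \<and> e \<in> Spec_map Q h F \<and> e' \<in> Spec_map Q h F \<and>
    x [^]\<^bsub>P\<^esub> n \<otimes>\<^bsub>P\<^esub> h e = h e'"
proof (rule ccontr)
  assume notor: "\<not> ?thesis"
  interpret P: comm_monoid_cancel P by fact
  interpret Q: comm_monoid Q by fact
  define E where "E = Spec_map Q h F"
  have E: "face Q E"
    unfolding E_def by (rule face_Spec_map[OF h Q F])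
  then have Ec: "E \<subseteq> carrier Q"
    by (simp add: face_def submonoid_def)
  have Fc: "F \<subseteq> carrier P"
    using F by (simp add: face_def submonoid_def)
  have "submonoid (h ` E) P"
  proof
    show "h ` E \<subseteq> carrier P"
      using Ec monoid_hom_closed[OF h] by auto
    show "\<one>\<^bsub>P\<^esub> \<in> h ` E"
      using submonoid.one_closed[OF face_submonoid[OF E]] monoid_hom_one[OF h] by (metis imageI)
    fix a b assume "a \<in> h ` E" "b \<in> h ` E"
    then show "a \<otimes>\<^bsub>P\<^esub> b \<in> h ` E"
      using submonoid.m_closed[OF face_submonoid[OF E]] monoid_hom_mult[OF h] Ec
      by (smt (verit) image_iff subsetD)
  qed
  \<comment> \<open>The negated claim is exactly the independence of \<open>x\<close> from the image
    of \<open>E\<close> that a separating character requires.\<close>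
  then have "\<exists>\<phi>. additive_on P (carrier P) \<phi> \<and> (\<forall>a\<in>h ` E. \<phi> a = 0) \<and> \<phi> x = 1"
  proof (rule P.additive_separating[OF P(2)])
    show "x \<in> carrier P" using x Fc by auto
    fix n :: nat and a b assume "n > 0" "a \<in> h ` E" "b \<in> h ` E"
    then show "x [^]\<^bsub>P\<^esub> n \<otimes>\<^bsub>P\<^esub> a \<noteq> b"
      using notor unfolding E_def by blast
  qed
  then obtain \<phi> where \<phi>: "additive_on P (carrier P) \<phi>" "\<And>e. e \<in> E \<Longrightarrow> \<phi> (h e) = 0" "\<phi> x = 1"
    by auto
  \<comment> \<open>The base \<open>Suc m\<close> is positive, so the value at the unit is 1.
    Extension by 0 off \<open>F\<close> stays multiplicative because \<open>F\<close> is a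
    face.\<close>
  define w :: "nat \<Rightarrow> 'b \<Rightarrow> real" where
    "w m p = (if p \<in> F then real (Suc m) powr \<phi> p else 0)" for m p
  define J where "J m = {a \<in> carrier (monoid_algebra P). alg_eval (w m) a = 0}" for m
  \<comment> \<open>The common contraction of all \<open>J m\<close>: as \<open>\<phi>\<close>
    vanishes on the image of \<open>E\<close>, the composite of \<open>w m\<close> with
    \<open>h\<close> is the indicator of \<open>E\<close> for every \<open>m\<close>.\<close>
  define I where "I = {a \<in> carrier (monoid_algebra Q). alg_eval (indicator E) a = 0}"
  have \<phi>_one: "\<phi> \<one>\<^bsub>P\<^esub> = 0"
    using P.additive_on_one[OF _ \<phi>(1)] by (simp add: submonoid_def)
  have J: "primeideal (J m) (monoid_algebra P)" for m
    unfolding J_def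
  proof (rule P.primeideal_alg_eval)
    fix p q assume "p \<in> carrier P" "q \<in> carrier P"
    then show "w m (p \<otimes>\<^bsub>P\<^esub> q) = w m p * w m q"
      using \<phi>(1) face_mult_iff[OF F] by (simp add: w_def additive_on_def powr_add)
  qed (use \<phi>_one submonoid.one_closed[OF face_submonoid[OF F]] in \<open>simp add: w_def\<close>)
  have I: "primeideal I (monoid_algebra Q)"
    unfolding I_def
  proof (rule Q.primeideal_alg_eval)
    fix p q assume "p \<in> carrier Q" "q \<in> carrier Q"
    then show "indicator E (p \<otimes>\<^bsub>Q\<^esub> q) = indicator E p * (indicator E q :: real)"
      using face_mult_iff[OF E] by (simp add: indicator_def)
  qed (use submonoid.one_closed[OF face_submonoid[OF E]] in simp)
  have JI: "{a \<in> carrier (monoid_algebra Q). algebra_map h a \<in> J m} = I" for m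
  proof -
    have "alg_eval (w m) (algebra_map h a) = alg_eval (indicator E) a"
      if "a \<in> carrier (monoid_algebra Q)" for a
      unfolding alg_eval_algebra_map
    proof (rule alg_eval_cong)
      fix p assume "p \<in> Poly_Mapping.keys a"
      then have "p \<in> carrier Q" using that by (auto simp: monoid_algebra_carrier)
      then show "(w m \<circ> h) p = indicator E p"
        using \<phi>(2)[of p] by (auto simp: w_def E_def Spec_map_def indicator_def)
    qed
    moreover have "algebra_map h a \<in> carrier (monoid_algebra P)"
      if "a \<in> carrier (monoid_algebra Q)" for a
      using algebra_map_carrier[OF _ that, of h P] monoid_hom_closed[OF h] by auto
    ultimately show ?thesis
      by (auto simp: J_def I_def)
  qed
  have "inj J"
  proof (rule injI)
    fix m n assume eq: "J m = J n"
    \<comment> \<open>This is \<open>x\<close> minus the constant \<open>m + 1\<close>. Under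
      \<open>w k\<close> it evaluates to \<open>k - m\<close>, so it lies in \<open>J k\<close> only
      for \<open>k = m\<close>.\<close>
    define y where "y = frag_of x - frag_cmul (int (Suc m)) (frag_of \<one>\<^bsub>P\<^esub>)"
    have keys: "Poly_Mapping.keys y \<subseteq> {x, \<one>\<^bsub>P\<^esub>}"
      unfolding y_def using keys_diff[of "frag_of x"] by (fastforce simp: keys_cmul)
    have const: "alg_eval w' (frag_cmul k (frag_of p)) = k * w' p" for w' :: "'b \<Rightarrow> real" and k p
      using alg_eval_superset[of "{p}" "frag_cmul k (frag_of p)" w'] by (simp add: subset_iff)
    have ev: "alg_eval (w k) y = real (Suc k) - real (Suc m)" for k
      using x \<phi> \<phi>_one submonoid.one_closed[OF face_submonoid[OF F]]
      by (simp add: y_def const w_def)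
    have "y \<in> J m"
      using keys x Fc ev by (auto simp: J_def monoid_algebra_carrier)
    then have "y \<in> J n"
      using eq by simp
    then have "alg_eval (w n) y = 0"
      by (simp add: J_def)
    then show "m = n" using ev[of n] by simp
  qed
  then have "infinite (range J)"
    using finite_imageD by blast
  moreover have "range J \<subseteq>
      {K. primeideal K (monoid_algebra P) \<and> {a \<in> carrier (monoid_algebra Q). algebra_map h a \<in> K} = I}"
    using J JI by auto
  ultimately show False
    using qf I finite_subset
    unfolding quasi_finite_monoid_map_def quasi_finite_ring_map_def by blast
qed

subsection \<open>Commensurability\<close>

context comm_monoid_cancel
begin

lemma pow_mult_cancel:
  assumes "t \<in> carrier G" "y \<in> carrier G" "a \<le> b" "y \<otimes> t [^] (a::nat) = t [^] b"
  shows "y = t [^] (b - a)"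
proof (rule r_cancel)
  show "y \<otimes> t [^] a = t [^] (b - a) \<otimes> t [^] a"
    using assms nat_pow_mult[of t "b - a" a] by simp
qed (use assms in auto)

text \<open>Cancelling \<open>t [^] b\<close> leaves \<open>y\<close> times a power of
  \<open>t\<close> equal to the unit element.\<close>

lemma pow_mult_cancel_unit:
  assumes t: "t \<in> carrier G" and y: "y \<in> carrier G" and ba: "b \<le> a" and eq: "y \<otimes> t [^] (a::nat) = t [^] b"
  shows "y \<in> Units G"
proof -
  have "(y \<otimes> t [^] (a - b)) \<otimes> t [^] b = \<one> \<otimes> t [^] b"
    using assms nat_pow_mult[of t "a - b" b] by (simp add: m_assoc)
  then have "y \<otimes> t [^] (a - b) = \<one>"
    by (rule r_cancel) (use t y in auto)
  then have "y \<otimes> t [^] (a - b) \<in> Units G"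
    by simp
  then show ?thesis
    using Units_mult_iff t y by blast
qed

text \<open>The divisors of powers of \<open>t\<close> form the smallest face containing
  \<open>t\<close>. Products of divisors divide products of powers, and factors of divisors are
  divisors.\<close>

lemma face_generated:
  assumes t: "t \<in> carrier G"
  shows "face G {p \<in> carrier G. \<exists>r\<in>carrier G. \<exists>k::nat. p \<otimes> r = t [^] k}" (is "face G ?F")
  unfolding face_def
proof (intro conjI ballI impI)
  show "submonoid ?F G"
  proof
    show "\<one> \<in> ?F" using t by (auto intro!: bexI[of _ \<one>] exI[of _ 0])
    fix p q assume "p \<in> ?F" "q \<in> ?F"
    then obtain r k s l where pq: "p \<in> carrier G" "q \<in> carrier G" "r \<in> carrier G" "s \<in> carrier G"
        "p \<otimes> r = t [^] (k::nat)" "q \<otimes> s = t [^] (l::nat)" by auto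
    have "(p \<otimes> q) \<otimes> (r \<otimes> s) = (p \<otimes> r) \<otimes> (q \<otimes> s)"
      using pq(1-4) by (simp add: m_ac)
    also have "\<dots> = t [^] (k + l)"
      using pq t by (simp add: nat_pow_mult)
    finally show "p \<otimes> q \<in> ?F" using pq(1-4) by blast
  qed auto
  fix p q assume pq: "p \<in> carrier G" "q \<in> carrier G" "p \<otimes> q \<in> ?F"
  then obtain r k where r: "r \<in> carrier G" "(p \<otimes> q) \<otimes> r = t [^] (k::nat)" by auto
  then have "p \<otimes> (q \<otimes> r) = t [^] k" "q \<otimes> (p \<otimes> r) = t [^] k"
    using pq(1,2) by (simp_all add: m_ac)
  then show "p \<in> ?F" "q \<in> ?F" using pq(1,2) r(1) by blast+
qed

end

text \<open>The image of a quasi-finite map, with quasi-finiteness expressed in terms of faces.\<close>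

locale quasi_finite_submonoid = comm_monoid_cancel G + B?: submonoid B G for G (structure) and B +
  assumes fg: "finitely_generated_monoid G"
    and face_torsion: "\<And>F f. face G F \<Longrightarrow> f \<in> F \<Longrightarrow>
      \<exists>n e e'. n > (0::nat) \<and> e \<in> B \<inter> F \<and> e' \<in> B \<inter> F \<and> f [^] n \<otimes> e = e'"
begin

text \<open>The elements with a positive power in the localization of \<open>B\<close> at those of
  its elements that are units of \<open>G\<close>, with the denominator \<open>e\<close>
  cleared.\<close>

definition commensurable :: "'a set" where
  "commensurable = {p \<in> carrier G. \<exists>n e q. n > (0::nat) \<and> e \<in> B \<inter> Units G \<and> q \<in> B \<and> p [^] n \<otimes> e = q}"

text \<open>Two relations multiply after being raised to the common exponent
  \<open>n * n'\<close>.\<close>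

lemma commensurable_submonoid: "submonoid commensurable G"
proof
  show "\<one> \<in> commensurable"
    unfolding commensurable_def by (auto intro!: exI[of _ "1::nat"] exI[of _ \<one>])
  show "commensurable \<subseteq> carrier G"
    by (auto simp: commensurable_def)
  fix p p' assume "p \<in> commensurable" "p' \<in> commensurable"
  then obtain n e q n' e' q' where
    p: "p \<in> carrier G" "n > (0::nat)" "e \<in> B \<inter> Units G" "q \<in> B" "p [^] n \<otimes> e = q" and
    p': "p' \<in> carrier G" "n' > (0::nat)" "e' \<in> B \<inter> Units G" "q' \<in> B" "p' [^] n' \<otimes> e' = q'"
    unfolding commensurable_def by blast
  have carr: "e \<in> carrier G" "e' \<in> carrier G" using p p' by auto
  have "(p \<otimes> p') [^] (n * n') \<otimes> (e [^] n' \<otimes> e' [^] n) = (p [^] n \<otimes> e) [^] n' \<otimes> (p' [^] n' \<otimes> e') [^] n"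
    using p(1) p'(1) carr by (simp add: nat_pow_distrib nat_pow_pow m_ac mult.commute)
  then have "(p \<otimes> p') [^] (n * n') \<otimes> (e [^] n' \<otimes> e' [^] n) = q [^] n' \<otimes> q' [^] n"
    using p(5) p'(5) by simp
  moreover have "e [^] n' \<otimes> e' [^] n \<in> B \<inter> Units G" "q [^] n' \<otimes> q' [^] n \<in> B"
    using p p' pow_submonoid[OF B.is_submonoid] Units_pow_closed by auto
  moreover have "n * n' > 0" using p p' by simp
  ultimately show "p \<otimes> p' \<in> commensurable"
    using p(1) p'(1) unfolding commensurable_def by blast
qed

lemma submonoid_subset_commensurable: "B \<subseteq> commensurable"
proof
  fix b assume "b \<in> B"
  then show "b \<in> commensurable"
    unfolding commensurable_def by (auto intro!: exI[of _ "1::nat"] exI[of _ \<one>])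
qed

text \<open>
  The face torsion of the face generated by \<open>t\<close> gives \<open>t ^ n * e = e'\<close> with \<open>e\<close> and \<open>e'\<close> in \<open>B\<close>
  dividing powers of \<open>t\<close>. An element \<open>b\<close> of \<open>B\<close> that divides a power of \<open>t\<close> either is a unit or
  yields a power of \<open>t\<close> in \<open>M\<close>: raise \<open>b * r = t ^ k\<close> to a power that brings \<open>r\<close> into
  \<open>adjoin M t\<close> and cancel powers of \<open>t\<close>. If \<open>e\<close> is a unit, then \<open>t\<close> is commensurable.
\<close>

lemma power_dense_step:
  assumes M: "submonoid M G" and t: "t \<in> carrier G" and C: "commensurable \<subseteq> M"
    and dense: "power_dense (adjoin M t)"
  shows "power_dense M"
proof -
  have Mc: "M \<subseteq> carrier G"
    using M by (simp add: submonoid_def)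
  let ?F = "{p \<in> carrier G. \<exists>r\<in>carrier G. \<exists>k::nat. p \<otimes> r = t [^] k}"
  have "t \<in> ?F"
    using t by (auto intro!: bexI[of _ \<one>] exI[of _ "1::nat"])
  then obtain n e e' where n: "n > (0::nat)" "e \<in> B \<inter> ?F" "e' \<in> B \<inter> ?F" "t [^] n \<otimes> e = e'"
    using face_torsion[OF face_generated[OF t]] by blast
  have alt: "(\<exists>j::nat. j > 0 \<and> t [^] j \<in> M) \<or> b \<in> Units G" if b: "b \<in> B \<inter> ?F" for b
  proof -
    obtain r k where r: "r \<in> carrier G" "b \<otimes> r = t [^] (k::nat)" and bc: "b \<in> carrier G"
      using b by auto
    obtain m x a where m: "m > (0::nat)" "x \<in> M" "r [^] m = x \<otimes> t [^] (a::nat)"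
      using dense r(1) unfolding power_dense_def adjoin_def by blast
    have x: "x \<in> carrier G" using m Mc by auto
    have "(b [^] m \<otimes> x) \<otimes> t [^] a = b [^] m \<otimes> r [^] m"
      using bc x t by (simp add: m m_assoc)
    also have "\<dots> = t [^] (k * m)"
      using bc r t by (simp add: nat_pow_distrib[symmetric] nat_pow_pow)
    finally have eq: "(b [^] m \<otimes> x) \<otimes> t [^] a = t [^] (k * m)" .
    \<comment> \<open>The comparison decides which side keeps a power of \<open>t\<close>;
      strictness makes the remaining exponent \<open>k * m - a\<close> positive.\<close>
    show ?thesis
    proof (cases "a < k * m")
      case True
      have "b [^] m \<otimes> x = t [^] (k * m - a)"
        using pow_mult_cancel[OF t _ _ eq] True bc x by simp
      moreover have "b [^] m \<otimes> x \<in> M"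
        using b m C submonoid_subset_commensurable pow_submonoid[OF M] submonoid.m_closed[OF M] by blast
      ultimately show ?thesis using True by (metis zero_less_diff)
    next
      case False
      then have "b [^] m \<otimes> x \<in> Units G"
        using pow_mult_cancel_unit[OF t _ _ eq] bc x by simp
      then have "b [^] m \<in> Units G"
        using Units_mult_iff bc x by blast
      then show ?thesis
        using face_pow_iff[OF face_Units bc m(1)] by blast
    qed
  qed
  have "\<exists>j::nat. j > 0 \<and> t [^] j \<in> M"
  proof (rule ccontr)
    assume none: "\<not> ?thesis"
    then have "e \<in> Units G" using alt n by blast
    then have "t \<in> commensurable"
      using n t unfolding commensurable_def by blast
    then have "t [^] (1::nat) \<in> M" using C t by auto
    then show False using none zero_less_one by blast
  qed
  then obtain j :: nat where j: "j > 0" "t [^] j \<in> M" by blast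
  \<comment> \<open>In \<open>p [^] m = x \<otimes> t [^] a\<close> the factor
    \<open>t [^] a\<close> enters \<open>M\<close> after raising to the power
    \<open>j\<close>.\<close>
  show ?thesis
    unfolding power_dense_def
  proof
    fix p assume p: "p \<in> carrier G"
    obtain m x a where m: "m > (0::nat)" "x \<in> M" "p [^] m = x \<otimes> t [^] (a::nat)"
      using dense p unfolding power_dense_def adjoin_def by blast
    have x: "x \<in> carrier G" using m Mc by auto
    have "p [^] (m * j) = (x \<otimes> t [^] a) [^] j"
      using p by (simp add: m(3)[symmetric] nat_pow_pow)
    also have "\<dots> = x [^] j \<otimes> (t [^] j) [^] a"
      using x t by (simp add: nat_pow_distrib nat_pow_pow mult.commute)
    also have "\<dots> \<in> M"
      using j m pow_submonoid[OF M] submonoid.m_closed[OF M] by blast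
    finally show "\<exists>n::nat. n > 0 \<and> p [^] n \<in> M"
      using m j by (metis nat_0_less_mult_iff)
  qed
qed

text \<open>Density descends from \<open>G\<close> to \<open>commensurable\<close> by removing
  generators, and \<open>commensurable\<close> is closed under taking roots.\<close>

lemma commensurable_eq_carrier: "commensurable = carrier G"
proof
  \<comment> \<open>The inclusion is part of the induction predicate: it passes from
    \<open>M\<close> to \<open>adjoin M t\<close>, where the induction hypothesis requires
    it.\<close>
  have "commensurable \<subseteq> M \<longrightarrow> power_dense M" if "submonoid M G" for M
    using fg that
  proof (induction M rule: submonoid_down_induct)
    case top
    then show ?case by (auto simp: power_dense_def intro!: exI[of _ "1::nat"])
  next
    case (step M t)
    then show ?case
      using power_dense_step adjoin_superset by (meson subset_trans)
  qed
  then have dense: "power_dense commensurable"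
    using commensurable_submonoid by blast
  \<comment> \<open>A relation for \<open>p [^] m\<close> with exponent \<open>n\<close> is a
    relation for \<open>p\<close> with exponent \<open>m * n\<close>.\<close>
  show "carrier G \<subseteq> commensurable"
  proof
    fix p assume p: "p \<in> carrier G"
    then obtain m n e q where "m > (0::nat)" "n > (0::nat)" "e \<in> B \<inter> Units G" "q \<in> B"
      "(p [^] m) [^] n \<otimes> e = q"
      using dense unfolding power_dense_def commensurable_def by blast
    then show "p \<in> commensurable"
      using p unfolding commensurable_def
      by (auto simp: nat_pow_pow intro!: exI[of _ "m * n"] exI[of _ e])
  qed
qed (auto simp: commensurable_def)

end

text \<open>If \<open>a\<close> and \<open>b\<close> agree after multiplication by \<open>c\<close>,
  they have the same class in the groupification, because the auxiliary factor \<open>g\<close> of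
  \<open>loc_rel\<close> can absorb \<open>c\<close>.\<close>

lemma fine_monoid_cancel:
  assumes "fine_monoid P"
  shows "comm_monoid_cancel P"
proof -
  interpret comm_monoid P
    using assms by (simp add: fine_monoid_def)
  show ?thesis
  proof (rule comm_monoid_cancelI)
    fix a b c assume abc: "a \<otimes>\<^bsub>P\<^esub> c = b \<otimes>\<^bsub>P\<^esub> c" "a \<in> carrier P" "b \<in> carrier P" "c \<in> carrier P"
    have le: "loc_map P (carrier P) a' \<subseteq> loc_map P (carrier P) b'"
      if eq: "a' \<otimes>\<^bsub>P\<^esub> c = b' \<otimes>\<^bsub>P\<^esub> c" and a'b': "a' \<in> carrier P" "b' \<in> carrier P" for a' b'
    proof
      fix z assume "z \<in> loc_map P (carrier P) a'"
      then obtain p f g where z: "z = (p, f)" "p \<in> carrier P" "f \<in> carrier P" "g \<in> carrier P"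
        "a' \<otimes>\<^bsub>P\<^esub> f \<otimes>\<^bsub>P\<^esub> g = p \<otimes>\<^bsub>P\<^esub> \<one>\<^bsub>P\<^esub> \<otimes>\<^bsub>P\<^esub> g"
        by (auto simp: loc_map_def loc_rel_def)
      have "b' \<otimes>\<^bsub>P\<^esub> f \<otimes>\<^bsub>P\<^esub> (g \<otimes>\<^bsub>P\<^esub> c) = (b' \<otimes>\<^bsub>P\<^esub> c) \<otimes>\<^bsub>P\<^esub> f \<otimes>\<^bsub>P\<^esub> g"
        using z(2-4) a'b' abc by (simp add: m_ac)
      also have "\<dots> = (a' \<otimes>\<^bsub>P\<^esub> f \<otimes>\<^bsub>P\<^esub> g) \<otimes>\<^bsub>P\<^esub> c"
        unfolding eq[symmetric] using z(2-4) a'b' abc(4) by (simp add: m_ac)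
      also have "\<dots> = p \<otimes>\<^bsub>P\<^esub> \<one>\<^bsub>P\<^esub> \<otimes>\<^bsub>P\<^esub> (g \<otimes>\<^bsub>P\<^esub> c)"
        unfolding z(5) using z(2-4) abc(4) by (simp add: m_ac)
      finally show "z \<in> loc_map P (carrier P) b'"
        using z(1-4) a'b' abc(4) unfolding loc_map_def loc_rel_def by blast
    qed
    have "loc_map P (carrier P) a = loc_map P (carrier P) b"
      using le[of a b] le[of b a] abc by auto
    then show "a = b"
      using assms abc by (auto simp: fine_monoid_def inj_on_def)
  qed (use assms in \<open>simp add: fine_monoid_def\<close>)
qed

subsection \<open>The spectrum map\<close>

lemma topspace_monoid_Spec:
  assumes "comm_monoid P"
  shows "topspace (monoid_Spec P) = {F. face P F}"
proof -
  interpret comm_monoid P by fact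
  have "\<one>\<^bsub>P\<^esub> \<in> F" if "face P F" for F
    using face_submonoid[OF that] by (simp add: submonoid_def)
  then show ?thesis
    unfolding monoid_Spec_def topology_generated_by_topspace by blast
qed

lemma openin_monoid_Spec_basic:
  "p \<in> carrier P \<Longrightarrow> openin (monoid_Spec P) {F. face P F \<and> p \<in> F}"
  unfolding monoid_Spec_def by (rule topology_generated_by_Basis) blast

lemma openin_monoid_Spec_finite:
  assumes "comm_monoid P" "finite A" "A \<subseteq> carrier P"
  shows "openin (monoid_Spec P) {F. face P F \<and> A \<subseteq> F}"
  using assms(2,3)
proof (induction A rule: finite_induct)
  case empty
  show ?case
    using openin_topspace[of "monoid_Spec P"] topspace_monoid_Spec[OF assms(1)] by simp
next
  case (insert a A)
  have "{F. face P F \<and> insert a A \<subseteq> F} = {F. face P F \<and> a \<in> F} \<inter> {F. face P F \<and> A \<subseteq> F}"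
    by blast
  then show ?case
    using insert openin_monoid_Spec_basic[of a P] by auto
qed

text \<open>A product lies in a face only if its factors do, so a face is generated by the
  generators it contains.\<close>

lemma face_subset_of_generators:
  assumes "comm_monoid P" "monoid_generators P S" "S \<subseteq> carrier P" "face P E" "submonoid H P" "S \<inter> E \<subseteq> H"
  shows "E \<subseteq> H"
proof -
  interpret comm_monoid P by fact
  \<comment> \<open>The elements satisfying the inclusion form a submonoid, as a product in
    \<open>E\<close> has both factors in \<open>E\<close>.\<close>
  let ?K = "{p \<in> carrier P. p \<in> E \<longrightarrow> p \<in> H}"
  have "submonoid ?K P"
    using submonoid.one_closed[OF assms(5)] submonoid.m_closed[OF assms(5)] face_mult_iff[OF assms(4)]
    by (auto intro!: submonoid.intro)
  then have "?K = carrier P"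
    using assms(2,3,6) unfolding monoid_generators_def by blast
  then show ?thesis
    using submonoid.subset[OF face_submonoid[OF assms(4)]] by blast
qed

text \<open>By finite generation, containing \<open>E\<close> amounts to containing finitely many
  elements, which is a finite intersection of basic open sets.\<close>

lemma openin_monoid_Spec_above_face:
  assumes P: "comm_monoid P" "finitely_generated_monoid P" and E: "face P E"
  shows "openin (monoid_Spec P) {F. face P F \<and> E \<subseteq> F}"
proof -
  obtain S where S: "finite S" "S \<subseteq> carrier P" "monoid_generators P S"
    using P(2) by (auto simp: finitely_generated_monoid_def monoid_generators_def)
  have "{F. face P F \<and> E \<subseteq> F} = {F. face P F \<and> S \<inter> E \<subseteq> F}"
    using face_subset_of_generators[OF P(1) S(3,2) E] face_submonoid by blast
  then show ?thesis
    using openin_monoid_Spec_finite[OF P(1), of "S \<inter> E"] S by auto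
qed

text \<open>Fineness enters as cancellation and finite generation, quasi-finiteness as torsion of
  the cokernels at the faces.\<close>

locale quasi_finite_embedding =
  Q: comm_monoid_cancel Q + P: comm_monoid_cancel P
  for Q :: "('a, 'm) monoid_scheme" and P :: "('b, 'n) monoid_scheme" and h :: "'a \<Rightarrow> 'b" +
  assumes fgQ: "finitely_generated_monoid Q" and fgP: "finitely_generated_monoid P"
    and hom: "monoid_hom Q P h" and inj: "inj_on h (carrier Q)"
    and torsion: "\<And>F f. face P F \<Longrightarrow> f \<in> F \<Longrightarrow>
      \<exists>n e e'. n > (0::nat) \<and> e \<in> Spec_map Q h F \<and> e' \<in> Spec_map Q h F \<and>
        f [^]\<^bsub>P\<^esub> n \<otimes>\<^bsub>P\<^esub> h e = h e'"
begin

text \<open>The image under the spectrum map of the closed point of \<open>P\<close>, and the face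
  at which \<open>Q\<close> is localized.\<close>

definition E0 :: "'a set" where "E0 = Spec_map Q h (Units P)"

lemma h_closed [simp]: "q \<in> carrier Q \<Longrightarrow> h q \<in> carrier P"
  using hom by (rule monoid_hom_closed)

lemma h_mult [simp]: "a \<in> carrier Q \<Longrightarrow> b \<in> carrier Q \<Longrightarrow> h (a \<otimes>\<^bsub>Q\<^esub> b) = h a \<otimes>\<^bsub>P\<^esub> h b"
  using hom by (rule monoid_hom_mult)

lemma h_one [simp]: "h \<one>\<^bsub>Q\<^esub> = \<one>\<^bsub>P\<^esub>"
  using hom by (rule monoid_hom_one)

lemma h_pow: "a \<in> carrier Q \<Longrightarrow> h (a [^]\<^bsub>Q\<^esub> (n::nat)) = h a [^]\<^bsub>P\<^esub> n"
  by (rule monoid_hom_pow[OF hom Q.comm_monoid_axioms])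

lemma h_eq_iff: "a \<in> carrier Q \<Longrightarrow> b \<in> carrier Q \<Longrightarrow> h a = h b \<longleftrightarrow> a = b"
  using inj by (auto simp: inj_on_def)

lemma face_pullback: "face P F \<Longrightarrow> face Q (Spec_map Q h F)"
  by (rule face_Spec_map[OF hom Q.comm_monoid_axioms])

lemma E0_face: "face Q E0"
  unfolding E0_def by (rule face_pullback[OF P.face_Units])

lemma E0_Unit: "e \<in> E0 \<Longrightarrow> h e \<in> Units P"
  by (simp add: E0_def Spec_map_def)

lemma E0_carrier: "e \<in> E0 \<Longrightarrow> e \<in> carrier Q"
  by (simp add: E0_def Spec_map_def)

lemma E0_subset_pullback: "face P F \<Longrightarrow> E0 \<subseteq> Spec_map Q h F"
  using P.Units_subset_face[of F] by (auto simp: E0_def Spec_map_def)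

lemma image_submonoid: "submonoid (h ` carrier Q) P"
proof
  show "\<one>\<^bsub>P\<^esub> \<in> h ` carrier Q"
    using h_one by (metis Q.one_closed imageI)
  fix a b assume "a \<in> h ` carrier Q" "b \<in> h ` carrier Q"
  then obtain x y where "x \<in> carrier Q" "y \<in> carrier Q" "a = h x" "b = h y" by blast
  then show "a \<otimes>\<^bsub>P\<^esub> b \<in> h ` carrier Q"
    by (intro image_eqI[of _ _ "x \<otimes>\<^bsub>Q\<^esub> y"]) auto
qed auto

text \<open>Commensurability for the image of \<open>h\<close>, pulled back to \<open>Q\<close>: an
  element of the image that is a unit of \<open>P\<close> comes from \<open>E0\<close>.\<close>

lemma commensurable_image:
  assumes "p \<in> carrier P"
  shows "\<exists>n e q. n > (0::nat) \<and> e \<in> E0 \<and> q \<in> carrier Q \<and> p [^]\<^bsub>P\<^esub> n \<otimes>\<^bsub>P\<^esub> h e = h q"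
proof -
  interpret B: quasi_finite_submonoid P "h ` carrier Q"
  proof (intro quasi_finite_submonoid.intro quasi_finite_submonoid_axioms.intro)
    fix F f assume "face P F" "f \<in> F"
    from torsion[OF this] obtain n e e' where
      "n > (0::nat)" "e \<in> Spec_map Q h F" "e' \<in> Spec_map Q h F" "f [^]\<^bsub>P\<^esub> n \<otimes>\<^bsub>P\<^esub> h e = h e'"
      by blast
    then show "\<exists>n e e'. n > (0::nat) \<and> e \<in> h ` carrier Q \<inter> F \<and> e' \<in> h ` carrier Q \<inter> F \<and>
        f [^]\<^bsub>P\<^esub> n \<otimes>\<^bsub>P\<^esub> e = e'"
      by (intro exI[of _ n] exI[of _ "h e"] exI[of _ "h e'"]) (auto simp: Spec_map_def)
  qed (rule P.comm_monoid_cancel_axioms, rule image_submonoid, rule fgP)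
  have "p \<in> B.commensurable"
    using assms by (simp add: B.commensurable_eq_carrier)
  then obtain n e q where "n > (0::nat)" "e \<in> h ` carrier Q \<inter> Units P" "q \<in> h ` carrier Q"
    "p [^]\<^bsub>P\<^esub> n \<otimes>\<^bsub>P\<^esub> e = q"
    unfolding B.commensurable_def by blast
  then show ?thesis
    unfolding E0_def Spec_map_def by blast
qed

text \<open>By torsion, \<open>f\<close> divides some \<open>h e'\<close> with \<open>e'\<close> in
  the smaller pullback. This element lies in \<open>F'\<close>, hence so does its divisor
  \<open>f\<close>.\<close>

lemma face_le_of_pullback_le:
  assumes F: "face P F" and F': "face P F'" and le: "Spec_map Q h F \<subseteq> Spec_map Q h F'"
  shows "F \<subseteq> F'"
proof
  fix f assume f: "f \<in> F"
  then have fc: "f \<in> carrier P"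
    using submonoid.subset[OF face_submonoid[OF F]] by blast
  obtain n e e' where n: "n > (0::nat)" "e \<in> Spec_map Q h F" "e' \<in> Spec_map Q h F"
    "f [^]\<^bsub>P\<^esub> n \<otimes>\<^bsub>P\<^esub> h e = h e'"
    using torsion[OF F f] by blast
  have ec: "e \<in> carrier Q" and "h e' \<in> F'"
    using n le by (auto simp: Spec_map_def)
  then have "f [^]\<^bsub>P\<^esub> n \<otimes>\<^bsub>P\<^esub> h e \<in> F'"
    using n by simp
  then have "f [^]\<^bsub>P\<^esub> n \<in> F'"
    using face_mult_iff[OF F', of "f [^]\<^bsub>P\<^esub> n" "h e"] fc ec by simp
  then show "f \<in> F'"
    using P.face_pow_iff[OF F' fc n(1)] by simp
qed

lemma Spec_map_inj: "inj_on (Spec_map Q h) {F. face P F}"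
  using face_le_of_pullback_le by (intro inj_onI) (simp add: subset_antisym)

text \<open>The faces of \<open>Q\<close> above \<open>E0\<close> are the faces of its localization at \<open>E0\<close>, and all of them extend.\<close>

lemma face_extend:
  assumes E: "face Q E" and le: "E0 \<subseteq> E"
  shows "\<exists>F. face P F \<and> Spec_map Q h F = E"
proof -
  \<comment> \<open>The elements commensurable with an element of \<open>E\<close>, with
    denominators from \<open>E0\<close>.\<close>
  define F where "F = {p \<in> carrier P. \<exists>n e e'. n > (0::nat) \<and> e \<in> E0 \<and> e' \<in> E \<and>
    p [^]\<^bsub>P\<^esub> n \<otimes>\<^bsub>P\<^esub> h e = h e'}"
  have Ec: "E \<subseteq> carrier Q"
    using submonoid.subset[OF face_submonoid[OF E]] .
  \<comment> \<open>Any single relation decides membership: two relations for the same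
    \<open>p\<close> are compared at a common power, and injectivity of \<open>h\<close> moves the
    comparison to \<open>Q\<close>.\<close>
  have mem: "p \<in> F \<longleftrightarrow> q \<in> E"
    if p: "p \<in> carrier P" and n: "n > (0::nat)" and e: "e \<in> E0" and q: "q \<in> carrier Q"
      and eq: "p [^]\<^bsub>P\<^esub> n \<otimes>\<^bsub>P\<^esub> h e = h q" for p n e q
  proof
    assume "p \<in> F"
    then obtain m d d' where m: "m > (0::nat)" "d \<in> E0" "d' \<in> E" "p [^]\<^bsub>P\<^esub> m \<otimes>\<^bsub>P\<^esub> h d = h d'"
      by (auto simp: F_def)
    have c: "e \<in> carrier Q" "d \<in> carrier Q" "d' \<in> carrier Q"
      using e m E0_carrier Ec by auto
    have "h (q [^]\<^bsub>Q\<^esub> m \<otimes>\<^bsub>Q\<^esub> d [^]\<^bsub>Q\<^esub> n) = (p [^]\<^bsub>P\<^esub> n \<otimes>\<^bsub>P\<^esub> h e) [^]\<^bsub>P\<^esub> m \<otimes>\<^bsub>P\<^esub> h d [^]\<^bsub>P\<^esub> n"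
      using c q by (simp add: h_pow eq)
    also have "\<dots> = (p [^]\<^bsub>P\<^esub> m \<otimes>\<^bsub>P\<^esub> h d) [^]\<^bsub>P\<^esub> n \<otimes>\<^bsub>P\<^esub> h e [^]\<^bsub>P\<^esub> m"
      using c p by (simp add: P.nat_pow_distrib P.nat_pow_pow P.m_ac mult.commute)
    also have "\<dots> = h (d' [^]\<^bsub>Q\<^esub> n \<otimes>\<^bsub>Q\<^esub> e [^]\<^bsub>Q\<^esub> m)"
      using c m(4) by (simp add: h_pow)
    finally have "q [^]\<^bsub>Q\<^esub> m \<otimes>\<^bsub>Q\<^esub> d [^]\<^bsub>Q\<^esub> n = d' [^]\<^bsub>Q\<^esub> n \<otimes>\<^bsub>Q\<^esub> e [^]\<^bsub>Q\<^esub> m"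
      using c q by (subst (asm) h_eq_iff) auto
    moreover have "d' [^]\<^bsub>Q\<^esub> n \<otimes>\<^bsub>Q\<^esub> e [^]\<^bsub>Q\<^esub> m \<in> E"
      using m(3) e le Q.pow_submonoid[OF face_submonoid[OF E]] submonoid.m_closed[OF face_submonoid[OF E]]
      by blast
    ultimately have "q [^]\<^bsub>Q\<^esub> m \<in> E"
      using face_mult_iff[OF E, of "q [^]\<^bsub>Q\<^esub> m" "d [^]\<^bsub>Q\<^esub> n"] c q by simp
    then show "q \<in> E"
      using Q.face_pow_iff[OF E q m(1)] by simp
  next
    assume "q \<in> E"
    then show "p \<in> F"
      using p n e eq unfolding F_def by blast
  qed
  have "face P F"
    unfolding face_def
  proof (intro conjI)
    \<comment> \<open>Multiplying relations for \<open>p\<close> and \<open>p'\<close> at a common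
      exponent turns the claim into the face property of \<open>E\<close>.\<close>
    have prod: "p \<otimes>\<^bsub>P\<^esub> p' \<in> F \<longleftrightarrow> p \<in> F \<and> p' \<in> F" if p: "p \<in> carrier P" "p' \<in> carrier P" for p p'
    proof -
      obtain n e q where n: "n > (0::nat)" "e \<in> E0" "q \<in> carrier Q" "p [^]\<^bsub>P\<^esub> n \<otimes>\<^bsub>P\<^esub> h e = h q"
        using commensurable_image[OF p(1)] by blast
      obtain m d r where m: "m > (0::nat)" "d \<in> E0" "r \<in> carrier Q" "p' [^]\<^bsub>P\<^esub> m \<otimes>\<^bsub>P\<^esub> h d = h r"
        using commensurable_image[OF p(2)] by blast
      have c: "e \<in> carrier Q" "d \<in> carrier Q"
        using n m E0_carrier by auto
      have "(p \<otimes>\<^bsub>P\<^esub> p') [^]\<^bsub>P\<^esub> (n * m) \<otimes>\<^bsub>P\<^esub> h (e [^]\<^bsub>Q\<^esub> m \<otimes>\<^bsub>Q\<^esub> d [^]\<^bsub>Q\<^esub> n) =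
          (p [^]\<^bsub>P\<^esub> n \<otimes>\<^bsub>P\<^esub> h e) [^]\<^bsub>P\<^esub> m \<otimes>\<^bsub>P\<^esub> (p' [^]\<^bsub>P\<^esub> m \<otimes>\<^bsub>P\<^esub> h d) [^]\<^bsub>P\<^esub> n"
        using p c by (simp add: h_pow P.nat_pow_distrib P.nat_pow_pow P.m_ac mult.commute)
      also have "\<dots> = h (q [^]\<^bsub>Q\<^esub> m \<otimes>\<^bsub>Q\<^esub> r [^]\<^bsub>Q\<^esub> n)"
        using n m by (simp add: h_pow)
      finally have eq: "(p \<otimes>\<^bsub>P\<^esub> p') [^]\<^bsub>P\<^esub> (n * m) \<otimes>\<^bsub>P\<^esub> h (e [^]\<^bsub>Q\<^esub> m \<otimes>\<^bsub>Q\<^esub> d [^]\<^bsub>Q\<^esub> n) =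
        h (q [^]\<^bsub>Q\<^esub> m \<otimes>\<^bsub>Q\<^esub> r [^]\<^bsub>Q\<^esub> n)" .
      have "e [^]\<^bsub>Q\<^esub> m \<otimes>\<^bsub>Q\<^esub> d [^]\<^bsub>Q\<^esub> n \<in> E0"
        using n m Q.pow_submonoid[OF face_submonoid[OF E0_face]]
          submonoid.m_closed[OF face_submonoid[OF E0_face]] by blast
      then have "p \<otimes>\<^bsub>P\<^esub> p' \<in> F \<longleftrightarrow> q [^]\<^bsub>Q\<^esub> m \<otimes>\<^bsub>Q\<^esub> r [^]\<^bsub>Q\<^esub> n \<in> E"
        using mem[OF _ _ _ _ eq] n m p by simp
      also have "\<dots> \<longleftrightarrow> q \<in> E \<and> r \<in> E"
        using n m by (simp add: face_mult_iff[OF E] Q.face_pow_iff[OF E])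
      also have "\<dots> \<longleftrightarrow> p \<in> F \<and> p' \<in> F"
        using mem[OF p(1) n] mem[OF p(2) m] by simp
      finally show ?thesis .
    qed
    have "\<one>\<^bsub>P\<^esub> \<in> F"
      using mem[of "\<one>\<^bsub>P\<^esub>" 1 "\<one>\<^bsub>Q\<^esub>" "\<one>\<^bsub>Q\<^esub>"] submonoid.one_closed[OF face_submonoid[OF E0_face]]
        submonoid.one_closed[OF face_submonoid[OF E]] by simp
    then show "submonoid F P"
      using prod by (intro submonoid.intro) (auto simp: F_def)
    show "\<forall>p\<in>carrier P. \<forall>p'\<in>carrier P. p \<otimes>\<^bsub>P\<^esub> p' \<in> F \<longrightarrow> p \<in> F \<and> p' \<in> F"
      using prod by blast
  qed
  \<comment> \<open>The trivial relation for \<open>h q\<close>, with exponent 1 and denominator the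
    unit element.\<close>
  moreover have "h q \<in> F \<longleftrightarrow> q \<in> E" if "q \<in> carrier Q" for q
    using mem[of "h q" 1 "\<one>\<^bsub>Q\<^esub>" q] submonoid.one_closed[OF face_submonoid[OF E0_face]] that by simp
  ultimately show ?thesis
    using Ec by (intro exI[of _ F]) (auto simp: Spec_map_def)
qed

text \<open>In \<open>p ^ n * h e = h q\<close> the factor \<open>h e\<close> is a unit of
  \<open>P\<close>, so a face contains \<open>p\<close> exactly when its pullback contains
  \<open>q\<close>; every face above \<open>E0\<close> is a pullback.\<close>

lemma Spec_map_image_basic:
  assumes p: "p \<in> carrier P"
  shows "\<exists>q\<in>carrier Q. Spec_map Q h ` {F. face P F \<and> p \<in> F} = {E. face Q E \<and> E0 \<subseteq> E} \<inter> {E. face Q E \<and> q \<in> E}"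
proof -
  obtain n e q where n: "n > (0::nat)" "e \<in> E0" "q \<in> carrier Q" "p [^]\<^bsub>P\<^esub> n \<otimes>\<^bsub>P\<^esub> h e = h q"
    using commensurable_image[OF p] by blast
  have mem: "p \<in> F \<longleftrightarrow> q \<in> Spec_map Q h F" if F: "face P F" for F
  proof -
    have "h e \<in> F"
      using P.Units_subset_face[OF F] E0_Unit[OF n(2)] by blast
    then have "p \<in> F \<longleftrightarrow> p [^]\<^bsub>P\<^esub> n \<otimes>\<^bsub>P\<^esub> h e \<in> F"
      using n(1,2) p E0_carrier by (simp add: face_mult_iff[OF F] P.face_pow_iff[OF F])
    then show ?thesis
      using n by (simp add: Spec_map_def)
  qed
  have "Spec_map Q h ` {F. face P F \<and> p \<in> F} = {E. face Q E \<and> E0 \<subseteq> E} \<inter> {E. face Q E \<and> q \<in> E}"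
  proof (intro equalityI subsetI)
    fix E assume "E \<in> {E. face Q E \<and> E0 \<subseteq> E} \<inter> {E. face Q E \<and> q \<in> E}"
    then show "E \<in> Spec_map Q h ` {F. face P F \<and> p \<in> F}"
      using face_extend[of E] mem by blast
  qed (use mem face_pullback E0_subset_pullback in blast)
  then show ?thesis using n by blast
qed

lemma continuous_Spec_map: "continuous_map (monoid_Spec P) (monoid_Spec Q) (Spec_map Q h)"
  unfolding monoid_Spec_def[of Q]
proof (rule continuous_on_generated_topo)
  fix U assume "U \<in> (\<lambda>q. {F. face Q F \<and> q \<in> F}) ` carrier Q"
  then obtain q where q: "q \<in> carrier Q" "U = {F. face Q F \<and> q \<in> F}" by blast
  have "Spec_map Q h -` U \<inter> topspace (monoid_Spec P) = {F. face P F \<and> h q \<in> F}"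
    using q face_pullback by (auto simp: topspace_monoid_Spec P.comm_monoid_axioms Spec_map_def)
  then show "openin (monoid_Spec P) (Spec_map Q h -` U \<inter> topspace (monoid_Spec P))"
    using openin_monoid_Spec_basic[of "h q" P] q(1) by simp
next
  show "Spec_map Q h ` topspace (monoid_Spec P) \<subseteq> \<Union> ((\<lambda>q. {F. face Q F \<and> q \<in> F}) ` carrier Q)"
    unfolding topology_generated_by_topspace[symmetric] monoid_Spec_def[symmetric]
    using face_pullback by (auto simp: topspace_monoid_Spec P.comm_monoid_axioms Q.comm_monoid_axioms)
qed

lemma open_Spec_map: "open_map (monoid_Spec P) (monoid_Spec Q) (Spec_map Q h)"
  unfolding open_map_def
proof (intro allI impI)
  fix U assume U: "openin (monoid_Spec P) U"
  then have "generate_topology_on ((\<lambda>p. {F. face P F \<and> p \<in> F}) ` carrier P) U"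
    by (simp add: monoid_Spec_def openin_topology_generated_by_iff)
  \<comment> \<open>Images commute with intersections only by injectivity on faces, so the induction
    also carries the inclusion of \<open>U\<close> in the set of faces.\<close>
  then have "U \<subseteq> {F. face P F} \<and> openin (monoid_Spec Q) (Spec_map Q h ` U)"
  proof (induction rule: generate_topology_on.induct)
    case (Int a b)
    then have "Spec_map Q h ` (a \<inter> b) = Spec_map Q h ` a \<inter> Spec_map Q h ` b"
      using inj_on_image_Int[OF Spec_map_inj] by blast
    then show ?case using Int by auto
  next
    case (UN K)
    then have "openin (monoid_Spec Q) (\<Union>k\<in>K. Spec_map Q h ` k)" by blast
    then show ?case using UN by (auto simp: image_Union)
  next
    case (Basis s)
    then obtain p where p: "p \<in> carrier P" "s = {F. face P F \<and> p \<in> F}" by blast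
    then obtain q where "q \<in> carrier Q"
      "Spec_map Q h ` s = {E. face Q E \<and> E0 \<subseteq> E} \<inter> {E. face Q E \<and> q \<in> E}"
      using Spec_map_image_basic by blast
    then show ?case
      using p openin_monoid_Spec_above_face[OF Q.comm_monoid_axioms fgQ E0_face]
        openin_monoid_Spec_basic[of q Q] by auto
  qed auto
  then show "openin (monoid_Spec Q) (Spec_map Q h ` U)" by blast
qed

end

subsection \<open>The factorization through the localization\<close>

context quasi_finite_embedding
begin

text \<open>\<open>quot (q, f)\<close> is the image in \<open>P\<close> of the formal difference \<open>q - f\<close>.\<close>

definition quot :: "'a \<times> 'a \<Rightarrow> 'b" where
  "quot = (\<lambda>(q, f). h q \<otimes>\<^bsub>P\<^esub> inv\<^bsub>P\<^esub> (h f))"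

lemma quot_closed: "z \<in> carrier Q \<times> E0 \<Longrightarrow> quot z \<in> carrier P"
  using E0_Unit by (auto simp: quot_def)

lemma quot_mult_denominator:
  assumes "(q, f) \<in> carrier Q \<times> E0"
  shows "quot (q, f) \<otimes>\<^bsub>P\<^esub> h f = h q"
  using assms E0_Unit E0_carrier by (simp add: quot_def P.m_assoc)

lemma quot_eq_iff:
  assumes "(q, f) \<in> carrier Q \<times> E0" "p \<in> carrier P"
  shows "quot (q, f) = p \<longleftrightarrow> h q = p \<otimes>\<^bsub>P\<^esub> h f"
proof -
  have "h f \<in> carrier P" "quot (q, f) \<in> carrier P"
    using assms(1) E0_carrier quot_closed by auto
  then show ?thesis
    using quot_mult_denominator[OF assms(1)] assms(2) P.r_cancel[of "quot (q, f)" "h f" p] by auto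
qed

lemma quot_mult:
  assumes "(q, f) \<in> carrier Q \<times> E0" "(q', f') \<in> carrier Q \<times> E0"
  shows "quot (q \<otimes>\<^bsub>Q\<^esub> q', f \<otimes>\<^bsub>Q\<^esub> f') = quot (q, f) \<otimes>\<^bsub>P\<^esub> quot (q', f')"
proof -
  have c: "q \<in> carrier Q" "q' \<in> carrier Q" "f \<in> carrier Q" "f' \<in> carrier Q"
    "quot (q, f) \<in> carrier P" "quot (q', f') \<in> carrier P"
    using assms E0_carrier quot_closed by auto
  have "h q \<otimes>\<^bsub>P\<^esub> h q' = (quot (q, f) \<otimes>\<^bsub>P\<^esub> quot (q', f')) \<otimes>\<^bsub>P\<^esub> (h f \<otimes>\<^bsub>P\<^esub> h f')"
    unfolding assms[THEN quot_mult_denominator, symmetric] using c by (simp add: P.m_ac)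
  moreover have "f \<otimes>\<^bsub>Q\<^esub> f' \<in> E0"
    using assms submonoid.m_closed[OF face_submonoid[OF E0_face]] by simp
  ultimately show ?thesis
    using c by (subst quot_eq_iff) simp_all
qed

lemma quot_one_denominator: "q \<in> carrier Q \<Longrightarrow> quot (q, \<one>\<^bsub>Q\<^esub>) = h q"
  by (simp add: quot_def)

text \<open>Cancellation in \<open>Q\<close> removes the auxiliary factor \<open>g\<close>,
  injectivity of \<open>h\<close> moves the cross-multiplied equation to \<open>P\<close>, and there
  the denominators are units.\<close>

lemma loc_rel_eq: "loc_rel Q E0 = {(z, z'). z \<in> carrier Q \<times> E0 \<and> z' \<in> carrier Q \<times> E0 \<and> quot z = quot z'}"
proof -
  have "(\<exists>g\<in>E0. q \<otimes>\<^bsub>Q\<^esub> f' \<otimes>\<^bsub>Q\<^esub> g = q' \<otimes>\<^bsub>Q\<^esub> f \<otimes>\<^bsub>Q\<^esub> g) \<longleftrightarrow> quot (q, f) = quot (q', f')"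
    if z: "q \<in> carrier Q" "f \<in> E0" "q' \<in> carrier Q" "f' \<in> E0" for q f q' f'
  proof -
    have c: "f \<in> carrier Q" "f' \<in> carrier Q" and u: "h f \<in> Units P" "h f' \<in> Units P"
      using z E0_carrier E0_Unit by auto
    have "(\<exists>g\<in>E0. q \<otimes>\<^bsub>Q\<^esub> f' \<otimes>\<^bsub>Q\<^esub> g = q' \<otimes>\<^bsub>Q\<^esub> f \<otimes>\<^bsub>Q\<^esub> g) \<longleftrightarrow> q \<otimes>\<^bsub>Q\<^esub> f' = q' \<otimes>\<^bsub>Q\<^esub> f"
    proof
      assume "\<exists>g\<in>E0. q \<otimes>\<^bsub>Q\<^esub> f' \<otimes>\<^bsub>Q\<^esub> g = q' \<otimes>\<^bsub>Q\<^esub> f \<otimes>\<^bsub>Q\<^esub> g"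
      then obtain g where g: "g \<in> E0" "q \<otimes>\<^bsub>Q\<^esub> f' \<otimes>\<^bsub>Q\<^esub> g = q' \<otimes>\<^bsub>Q\<^esub> f \<otimes>\<^bsub>Q\<^esub> g" by blast
      then show "q \<otimes>\<^bsub>Q\<^esub> f' = q' \<otimes>\<^bsub>Q\<^esub> f"
        by (intro Q.r_cancel[OF g(2)] Q.m_closed) (simp_all add: z c E0_carrier g(1))
    qed (use z in auto)
    also have "\<dots> \<longleftrightarrow> h q \<otimes>\<^bsub>P\<^esub> h f' = h q' \<otimes>\<^bsub>P\<^esub> h f"
      using z c h_eq_iff[of "q \<otimes>\<^bsub>Q\<^esub> f'" "q' \<otimes>\<^bsub>Q\<^esub> f"] by simp
    also have "\<dots> \<longleftrightarrow> quot (q, f) = quot (q', f')"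
    proof -
      have v: "quot (q', f') \<in> carrier P"
        using z by (intro quot_closed) auto
      have q': "h q' = quot (q', f') \<otimes>\<^bsub>P\<^esub> h f'"
        using quot_eq_iff[OF _ v, of q' f'] z by simp
      have eq: "h q' \<otimes>\<^bsub>P\<^esub> h f = (quot (q', f') \<otimes>\<^bsub>P\<^esub> h f) \<otimes>\<^bsub>P\<^esub> h f'"
        unfolding q' using v c by (simp add: P.m_ac)
      have "quot (q, f) = quot (q', f') \<longleftrightarrow> h q = quot (q', f') \<otimes>\<^bsub>P\<^esub> h f"
        using z by (intro quot_eq_iff[OF _ v]) auto
      also have "\<dots> \<longleftrightarrow> h q \<otimes>\<^bsub>P\<^esub> h f' = (quot (q', f') \<otimes>\<^bsub>P\<^esub> h f) \<otimes>\<^bsub>P\<^esub> h f'"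
        using P.r_cancel[of "h q" "h f'"] z(1) c v by (metis P.m_closed h_closed)
      finally show ?thesis unfolding eq by blast
    qed
    finally show ?thesis .
  qed
  then show ?thesis
    unfolding loc_rel_def by blast
qed

text \<open>The fiber of \<open>quot\<close> over \<open>p\<close>; the nonempty fibers are the
  elements of the localization.\<close>

definition loc_class :: "'b \<Rightarrow> ('a \<times> 'a) set" where
  "loc_class p = {z \<in> carrier Q \<times> E0. quot z = p}"

lemma loc_rel_class: "z \<in> carrier Q \<times> E0 \<Longrightarrow> loc_rel Q E0 `` {z} = loc_class (quot z)"
  unfolding loc_rel_eq loc_class_def by auto

lemma localization_carrier: "carrier (localization Q E0) = (\<lambda>z. loc_class (quot z)) ` (carrier Q \<times> E0)"
  unfolding localization_def quotient_def using loc_rel_class by auto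

lemma the_elem_loc_class: "z \<in> carrier Q \<times> E0 \<Longrightarrow> the_elem (quot ` loc_class (quot z)) = quot z"
proof -
  assume "z \<in> carrier Q \<times> E0"
  then have "quot ` loc_class (quot z) = {quot z}"
    by (auto simp: loc_class_def)
  then show ?thesis by simp
qed

text \<open>The union defining the product runs over all representatives, but each gives the same
  class; the union collapses since the two factors are nonempty.\<close>

lemma localization_mult:
  assumes z: "z \<in> carrier Q \<times> E0" and z': "z' \<in> carrier Q \<times> E0"
  shows "loc_class (quot z) \<otimes>\<^bsub>localization Q E0\<^esub> loc_class (quot z') = loc_class (quot z \<otimes>\<^bsub>P\<^esub> quot z')"
proof -
  have *: "loc_rel Q E0 `` {(q \<otimes>\<^bsub>Q\<^esub> q', f \<otimes>\<^bsub>Q\<^esub> f')} = loc_class (quot z \<otimes>\<^bsub>P\<^esub> quot z')"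
    if "(q, f) \<in> loc_class (quot z)" "(q', f') \<in> loc_class (quot z')" for q f q' f'
  proof -
    have "(q \<otimes>\<^bsub>Q\<^esub> q', f \<otimes>\<^bsub>Q\<^esub> f') \<in> carrier Q \<times> E0"
      using that submonoid.m_closed[OF face_submonoid[OF E0_face]] by (auto simp: loc_class_def)
    then show ?thesis
      using that quot_mult[of q f q' f'] by (simp add: loc_rel_class) (simp add: loc_class_def)
  qed
  have ne: "z \<in> loc_class (quot z)" "z' \<in> loc_class (quot z')"
    using z z' by (auto simp: loc_class_def)
  have "loc_class (quot z) \<otimes>\<^bsub>localization Q E0\<^esub> loc_class (quot z') =
      (\<Union>(q, f)\<in>loc_class (quot z). \<Union>(q', f')\<in>loc_class (quot z'). loc_rel Q E0 `` {(q \<otimes>\<^bsub>Q\<^esub> q', f \<otimes>\<^bsub>Q\<^esub> f')})"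
    by (simp add: localization_def)
  also have "\<dots> = (\<Union>_\<in>loc_class (quot z). \<Union>_\<in>loc_class (quot z'). loc_class (quot z \<otimes>\<^bsub>P\<^esub> quot z'))"
  proof (intro SUP_cong[OF refl])
    fix a assume "a \<in> loc_class (quot z)"
    then show "(case a of (q, f) \<Rightarrow> \<Union>(q', f')\<in>loc_class (quot z').
        loc_rel Q E0 `` {(q \<otimes>\<^bsub>Q\<^esub> q', f \<otimes>\<^bsub>Q\<^esub> f')}) =
      (\<Union>_\<in>loc_class (quot z'). loc_class (quot z \<otimes>\<^bsub>P\<^esub> quot z'))"
      by (cases a) (auto simp only: prod.case intro!: SUP_cong[OF refl] split: prod.split dest: *)
  qed
  also have "\<dots> = loc_class (quot z \<otimes>\<^bsub>P\<^esub> quot z')"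
    using ne by blast
  finally show ?thesis .
qed

text \<open>A commensurability relation for \<open>p\<close> says that \<open>p ^ n\<close> is the
  quotient \<open>quot (q, e)\<close>.\<close>

lemma quot_image_dense: "submonoid (quot ` (carrier Q \<times> E0)) P" "P.power_dense (quot ` (carrier Q \<times> E0))"
proof -
  have one: "\<one>\<^bsub>Q\<^esub> \<in> E0"
    using submonoid.one_closed[OF face_submonoid[OF E0_face]] .
  show "submonoid (quot ` (carrier Q \<times> E0)) P"
  proof
    show "quot ` (carrier Q \<times> E0) \<subseteq> carrier P"
      using quot_closed by blast
    show "\<one>\<^bsub>P\<^esub> \<in> quot ` (carrier Q \<times> E0)"
      using one by (intro image_eqI[of _ _ "(\<one>\<^bsub>Q\<^esub>, \<one>\<^bsub>Q\<^esub>)"]) (auto simp: quot_one_denominator)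
    fix a b assume "a \<in> quot ` (carrier Q \<times> E0)" "b \<in> quot ` (carrier Q \<times> E0)"
    then obtain q f q' f' where "(q, f) \<in> carrier Q \<times> E0" "(q', f') \<in> carrier Q \<times> E0"
      "a = quot (q, f)" "b = quot (q', f')" by blast
    then show "a \<otimes>\<^bsub>P\<^esub> b \<in> quot ` (carrier Q \<times> E0)"
      using submonoid.m_closed[OF face_submonoid[OF E0_face]]
      by (intro image_eqI[of _ _ "(q \<otimes>\<^bsub>Q\<^esub> q', f \<otimes>\<^bsub>Q\<^esub> f')"]) (auto simp: quot_mult)
  qed
  show "P.power_dense (quot ` (carrier Q \<times> E0))"
    unfolding P.power_dense_def
  proof
    fix p assume p: "p \<in> carrier P"
    from commensurable_image[OF this] obtain n e q where n: "n > (0::nat)" "e \<in> E0" "q \<in> carrier Q"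
      "p [^]\<^bsub>P\<^esub> n \<otimes>\<^bsub>P\<^esub> h e = h q" by blast
    then have "quot (q, e) = p [^]\<^bsub>P\<^esub> n"
      by (subst quot_eq_iff) (simp_all add: p)
    then have "p [^]\<^bsub>P\<^esub> n \<in> quot ` (carrier Q \<times> E0)"
      using n by (intro image_eqI[of _ _ "(q, e)"]) auto
    then show "\<exists>n::nat. n > 0 \<and> p [^]\<^bsub>P\<^esub> n \<in> quot ` (carrier Q \<times> E0)"
      using n by blast
  qed
qed

lemma localization_factor:
  "\<exists>g. monoid_hom (localization Q E0) P g \<and> (\<forall>q\<in>carrier Q. g (loc_map Q E0 q) = h q) \<and>
     finite_monoid_map (localization Q E0) P g \<and> inj_on g (carrier (localization Q E0))"
proof -
  \<comment> \<open>\<open>quot\<close> is constant on each class, so its image there is a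
    singleton.\<close>
  define g where "g A = the_elem (quot ` A)" for A
  have one: "\<one>\<^bsub>Q\<^esub> \<in> E0"
    using submonoid.one_closed[OF face_submonoid[OF E0_face]] .
  have g: "g (loc_class (quot z)) = quot z" if "z \<in> carrier Q \<times> E0" for z
    unfolding g_def by (rule the_elem_loc_class[OF that])
  have gmap: "g (loc_rel Q E0 `` {(q, \<one>\<^bsub>Q\<^esub>)}) = h q" if "q \<in> carrier Q" for q
    using g[of "(q, \<one>\<^bsub>Q\<^esub>)"] loc_rel_class[of "(q, \<one>\<^bsub>Q\<^esub>)"] that one by (simp add: quot_one_denominator)
  have gmult: "g (A \<otimes>\<^bsub>localization Q E0\<^esub> B) = g A \<otimes>\<^bsub>P\<^esub> g B"
    if AB: "A \<in> carrier (localization Q E0)" "B \<in> carrier (localization Q E0)" for A B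
  proof -
    obtain z z' where z: "z \<in> carrier Q \<times> E0" "z' \<in> carrier Q \<times> E0"
      "A = loc_class (quot z)" "B = loc_class (quot z')"
      using AB unfolding localization_carrier by blast
    have "quot z \<otimes>\<^bsub>P\<^esub> quot z' \<in> quot ` (carrier Q \<times> E0)"
      using submonoid.m_closed[OF quot_image_dense(1)] z by blast
    then obtain y where "y \<in> carrier Q \<times> E0" "quot z \<otimes>\<^bsub>P\<^esub> quot z' = quot y" by blast
    then show ?thesis
      unfolding z(3,4) localization_mult[OF z(1,2)] using z g by simp
  qed
  have im: "g ` carrier (localization Q E0) = quot ` (carrier Q \<times> E0)"
    unfolding localization_carrier image_image using g by (intro image_cong) auto
  have "monoid_hom (localization Q E0) P g"
  proof -
    have "g \<in> carrier (localization Q E0) \<rightarrow> carrier P"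
      using im submonoid.subset[OF quot_image_dense(1)] by (metis image_subset_iff_funcset)
    moreover have "g \<one>\<^bsub>localization Q E0\<^esub> = \<one>\<^bsub>P\<^esub>"
      using gmap[of "\<one>\<^bsub>Q\<^esub>"] by (simp add: localization_def)
    ultimately show ?thesis
      using gmult by (auto simp: monoid_hom_def hom_def)
  qed
  moreover have "\<forall>q\<in>carrier Q. g (loc_map Q E0 q) = h q"
    using gmap by (simp add: loc_map_def)
  moreover have "finite_monoid_map (localization Q E0) P g"
    using P.power_dense_finite[OF fgP quot_image_dense]
    unfolding im[symmetric] by (simp add: finite_monoid_map_def)
  \<comment> \<open>A class is the fiber of \<open>quot\<close> over its value under
    \<open>g\<close>, so the value determines the class.\<close>
  moreover have "inj_on g (carrier (localization Q E0))"
    unfolding localization_carrier using g by (auto intro!: inj_onI)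
  ultimately show ?thesis by blast
qed

text \<open>The units of \<open>Q\<close> form a face, hence a pullback, and every pullback contains
  \<open>E0\<close>. All denominators are then invertible in \<open>Q\<close> itself, so powers land
  in the image of \<open>h\<close>.\<close>

lemma finite_of_surjective:
  assumes "{E. face Q E} \<subseteq> Spec_map Q h ` {F. face P F}"
  shows "finite_monoid_map Q P h"
proof -
  obtain F where F: "face P F" "Spec_map Q h F = Units Q"
    using assms Q.face_Units by blast
  then have E0: "E0 \<subseteq> Units Q"
    using E0_subset_pullback by auto
  have "P.power_dense (h ` carrier Q)"
    unfolding P.power_dense_def
  proof
    fix p assume p: "p \<in> carrier P"
    from commensurable_image[OF this] obtain n e q where n: "n > (0::nat)" "e \<in> E0" "q \<in> carrier Q"
      "p [^]\<^bsub>P\<^esub> n \<otimes>\<^bsub>P\<^esub> h e = h q" by blast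
    have e: "e \<in> Units Q" "e \<in> carrier Q" using n E0 by auto
    have "h (q \<otimes>\<^bsub>Q\<^esub> inv\<^bsub>Q\<^esub> e) = p [^]\<^bsub>P\<^esub> n \<otimes>\<^bsub>P\<^esub> h (e \<otimes>\<^bsub>Q\<^esub> inv\<^bsub>Q\<^esub> e)"
      using n(3) e p by (simp add: n(4)[symmetric] P.m_assoc del: Q.Units_r_inv)
    then have "p [^]\<^bsub>P\<^esub> n = h (q \<otimes>\<^bsub>Q\<^esub> inv\<^bsub>Q\<^esub> e)"
      using e p by simp
    then show "\<exists>n::nat. n > 0 \<and> p [^]\<^bsub>P\<^esub> n \<in> h ` carrier Q"
      using n(1,3) e by blast
  qed
  from P.power_dense_finite[OF fgP image_submonoid this] show ?thesis
    by (simp add: finite_monoid_map_def)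
qed

end

theorem lemma4p8p10:
  fixes Q :: "('a, 'm) monoid_scheme" and P :: "('b, 'n) monoid_scheme" and h :: "'a \<Rightarrow> 'b"
  assumes "fine_monoid Q" and "fine_monoid P"
    and "monoid_hom Q P h" and "inj_on h (carrier Q)"
    and "quasi_finite_monoid_map Q P h"
  shows "(embedding_map (monoid_Spec P) (monoid_Spec Q) (Spec_map Q h) \<and>
          open_map (monoid_Spec P) (monoid_Spec Q) (Spec_map Q h)) \<and>
         (homeomorphic_map (monoid_Spec P) (monoid_Spec Q) (Spec_map Q h) \<longleftrightarrow>
          Spec_map Q h ` topspace (monoid_Spec P) = topspace (monoid_Spec Q)) \<and>
         (homeomorphic_map (monoid_Spec P) (monoid_Spec Q) (Spec_map Q h) \<longrightarrow>
          finite_monoid_map Q P h) \<and>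
         (let F = Spec_map Q h (Units P) in
          face Q F \<and>
          (\<exists>g. monoid_hom (localization Q F) P g \<and>
               (\<forall>q\<in>carrier Q. g (loc_map Q F q) = h q) \<and>
               finite_monoid_map (localization Q F) P g \<and>
               inj_on g (carrier (localization Q F))))"
proof -
  interpret Q: comm_monoid_cancel Q
    using assms(1) by (rule fine_monoid_cancel)
  interpret P: comm_monoid_cancel P
    using assms(2) by (rule fine_monoid_cancel)
  interpret quasi_finite_embedding Q P h
  proof
    fix F f assume "face P F" "f \<in> F"
    then show "\<exists>n e e'. n > (0::nat) \<and> e \<in> Spec_map Q h F \<and> e' \<in> Spec_map Q h F \<and>
        f [^]\<^bsub>P\<^esub> n \<otimes>\<^bsub>P\<^esub> h e = h e'"
      using quasi_finite_face_torsion[OF P.comm_monoid_cancel_axioms _ Q.comm_monoid_axioms assms(3,5)]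
        assms(2) by (simp add: fine_monoid_def)
  qed (use assms in \<open>simp_all add: fine_monoid_def\<close>)
  note top = topspace_monoid_Spec[OF P.comm_monoid_axioms] topspace_monoid_Spec[OF Q.comm_monoid_axioms]
  have inj: "inj_on (Spec_map Q h) (topspace (monoid_Spec P))"
    using Spec_map_inj by (simp add: top)
  have homeo: "homeomorphic_map (monoid_Spec P) (monoid_Spec Q) (Spec_map Q h) \<longleftrightarrow>
      Spec_map Q h ` topspace (monoid_Spec P) = topspace (monoid_Spec Q)"
    using bijective_open_imp_homeomorphic_map[OF continuous_Spec_map open_Spec_map _ inj]
      homeomorphic_imp_surjective_map by blast
  moreover have "embedding_map (monoid_Spec P) (monoid_Spec Q) (Spec_map Q h)"
    by (rule injective_open_imp_embedding_map[OF continuous_Spec_map open_Spec_map inj])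
  moreover have "finite_monoid_map Q P h"
    if "Spec_map Q h ` topspace (monoid_Spec P) = topspace (monoid_Spec Q)"
    using finite_of_surjective that by (simp add: top)
  ultimately show ?thesis
    using open_Spec_map E0_face localization_factor unfolding E0_def Let_def by blast
qed

end
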